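(* Consider the dual risk model described in the context, with parameters $\lambda,\mu>0$, $a\ge 0$, $c\in(0,1)$, $\theta\in[-1,1]$, and put $\bar c=1-c$. Let $R(x)$ be the ruin probability started from surplus level $x$ and $\rho(s)=\int_0^\infty e^{-sx}R(x)\,dx$ its Laplace transform. Define $\zeta(s)=\frac{s}{\bar c(1+a)}$, with iterates $\zeta^{(0)}(s)=s$, $\zeta^{(j)}(s)=\zeta(\zeta^{(j-1)}(s))=\frac{s}{(\bar c(1+a))^{j}}$, and $$J(s;\theta)=\frac{\lambda\mu\bar c\,\big[(s+2\lambda\bar c)(2\mu\bar c(1+a)-s)-\theta s^{2}\big]}{(s+2\lambda\bar c)(2\mu\bar c(1+a)-s)(s+\lambda\bar c)(\mu\bar c(1+a)-s)},$$ $$H(s;\theta)=\frac{1}{s+\lambda\bar c}\left(1-\lambda\mu\bar c\left[\frac{s(1-\theta)+2\lambda\bar c}{(s+2\lambda\bar c)(\mu\bar c(1+a)-s)}\rho(\mu)+\frac{2\theta s}{(s+2\lambda\bar c)(2\mu\bar c(1+a)-s)}\rho(2\mu)\right]\right).$$ Then the Laplace transform of the ruin probability is given by $$\rho(s)=\sum_{k=0}^{\infty}\Big(\prod_{j=0}^{k-1}J(\zeta^{(j)}(s);\theta)\Big)H(\zeta^{(k)}(s);\theta),$$ an empty product being $1$. The unknowns $\rho(\mu)$ and $\rho(2\mu)$ (which appear with a prefactor in all $H(\zeta^{(k)}(s);\theta)$) are derived from the system of equations that is constructed by substituting $s=\mu$ and $s=2\mu$ in this identity.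
   Context: Model. The surplus starts at $x>0$ and decreases at unit rate between gains. Gain interarrival times depend linearly on the surplus level: if the surplus is at level $x$ (initially or right after a gain), then the time until the next gain is $cx+B$, where $c\in(0,1)$. If the surplus just before the gain is $u$, it jumps up to $(1+a)u+C$, with $C$ the gain size. The pairs $(B,C)$ used at successive gains are i.i.d.; marginally $B\sim\exp(\lambda)$ and $C\sim\exp(\mu)$, and they are dependent through the Farlie–Gumbel–Morgenstern copula with parameter $\theta\in[-1,1]$, i.e. with joint density $$f_{B,C}(t,y)=\lambda e^{-\lambda t}\mu e^{-\mu y}+\theta(2\lambda e^{-2\lambda t}-\lambda e^{-\lambda t})(2\mu e^{-2\mu y}-\mu e^{-\mu y}),\qquad t,y\ge 0.$$ Ruin occurs when the surplus hits $0$; $R(x)$ is the probability that ruin ever occurs starting from $x$. Thus $$R(x)=e^{-\lambda(1-c)x}+\int_{t=cx}^{x}\int_{y=0}^{\infty}R((1+a)(x-t)+y)f_{B,C}(t-cx,y)\,dy\,dt.$$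
   Formalization: Proved for Re s>0 with no iterate ζ^(j)(s) equal to μc̄(1+a) or 2μc̄(1+a), where terms are undefined; if c̄(1+a)=1, also |J(s;θ)|<1, as the series otherwise diverges. The system determines ρ(μ), ρ(2μ) uniquely when its terms at s=μ, 2μ are defined. *)

theory Defs
  imports "HOL-Probability.Probability"
begin

definition fgm_exp_density :: "real \<Rightarrow> real \<Rightarrow> real \<Rightarrow> real \<times> real \<Rightarrow> real" where
  "fgm_exp_density lam \<mu> \<theta> = (\<lambda>(t, y).
     if t < 0 \<or> y < 0 then 0
     else lam * exp (- lam * t) * (\<mu> * exp (- \<mu> * y))
        + \<theta> * (2 * lam * exp (- 2 * lam * t) - lam * exp (- lam * t))
            * (2 * \<mu> * exp (- 2 * \<mu> * y) - \<mu> * exp (- \<mu> * y)))"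

text \<open>
  The sequences \<open>b\<close> and \<open>y\<close> are one realisation of the pairs \<open>(B, C)\<close> used at the successive
  gains.  \<open>level_after a c b y x n\<close> is the surplus right after the \<open>n\<close>-th gain (for \<open>n = 0\<close>, the
  initial surplus \<open>x\<close>).  The recursion is continued formally past ruin; since ruin asks for some
  hitting of \<open>0\<close>, and the first hitting only involves levels before it, this has no effect on the
  ruin event.
\<close>

definition interarrival :: "real \<Rightarrow> real \<Rightarrow> real \<Rightarrow> real" where
  "interarrival c u b = c * u + b"

primrec level_after :: "real \<Rightarrow> real \<Rightarrow> (nat \<Rightarrow> real) \<Rightarrow> (nat \<Rightarrow> real) \<Rightarrow> real \<Rightarrow> nat \<Rightarrow> real" where
  "level_after a c b y x 0 = x"
| "level_after a c b y x (Suc n) =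
     (1 + a) * (level_after a c b y x n - interarrival c (level_after a c b y x n) (b n)) + y n"

definition ruined :: "real \<Rightarrow> real \<Rightarrow> (nat \<Rightarrow> real) \<Rightarrow> (nat \<Rightarrow> real) \<Rightarrow> real \<Rightarrow> bool" where
  "ruined a c b y x \<longleftrightarrow>
     (\<exists>n. \<exists>\<tau>. 0 \<le> \<tau> \<and> \<tau> \<le> interarrival c (level_after a c b y x n) (b n)
            \<and> level_after a c b y x n - \<tau> = 0)"

definition ruin_prob ::
  "'w measure \<Rightarrow> (nat \<Rightarrow> 'w \<Rightarrow> real) \<Rightarrow> (nat \<Rightarrow> 'w \<Rightarrow> real) \<Rightarrow> real \<Rightarrow> real \<Rightarrow> real \<Rightarrow> real" where
  "ruin_prob M B C a c x =
     measure M {\<omega> \<in> space M. ruined a c (\<lambda>n. B n \<omega>) (\<lambda>n. C n \<omega>) x}"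

definition laplace_transform :: "(real \<Rightarrow> real) \<Rightarrow> complex \<Rightarrow> complex" where
  "laplace_transform f s = (LINT x:{0..}|lborel. exp (- s * of_real x) * of_real (f x))"

definition zeta :: "real \<Rightarrow> real \<Rightarrow> complex \<Rightarrow> complex" where
  "zeta a c s = s / of_real ((1 - c) * (1 + a))"

definition J :: "real \<Rightarrow> real \<Rightarrow> real \<Rightarrow> real \<Rightarrow> real \<Rightarrow> complex \<Rightarrow> complex" where
  "J lam \<mu> a c \<theta> s =
     (let l = of_real lam; m = of_real \<mu>; d = of_real (1 - c); g = of_real (1 + a); th = of_real \<theta> in
      l * m * d * ((s + 2 * l * d) * (2 * m * d * g - s) - th * s^2)
      / ((s + 2 * l * d) * (2 * m * d * g - s) * (s + l * d) * (m * d * g - s)))"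

text \<open>The arguments \<open>p\<close> and \<open>q\<close> stand for the unknown values at \<open>\<mu>\<close> and \<open>2 * \<mu>\<close> of the
  Laplace transform of the ruin probability.\<close>

definition H ::
  "real \<Rightarrow> real \<Rightarrow> real \<Rightarrow> real \<Rightarrow> real \<Rightarrow> complex \<Rightarrow> complex \<Rightarrow> complex \<Rightarrow> complex" where
  "H lam \<mu> a c \<theta> p q s =
     (let l = of_real lam; m = of_real \<mu>; d = of_real (1 - c); g = of_real (1 + a); th = of_real \<theta> in
      1 / (s + l * d) *
      (1 - l * m * d *
         ((s * (1 - th) + 2 * l * d) / ((s + 2 * l * d) * (m * d * g - s)) * p
          + 2 * th * s / ((s + 2 * l * d) * (2 * m * d * g - s)) * q)))"

definition series_term ::
  "real \<Rightarrow> real \<Rightarrow> real \<Rightarrow> real \<Rightarrow> real \<Rightarrow> complex \<Rightarrow> complex \<Rightarrow> complex \<Rightarrow> nat \<Rightarrow> complex" where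
  "series_term lam \<mu> a c \<theta> p q s k =
     (\<Prod>j<k. J lam \<mu> a c \<theta> ((zeta a c ^^ j) s)) * H lam \<mu> a c \<theta> p q ((zeta a c ^^ k) s)"

text \<open>For \<open>Re s > 0\<close> the only denominators in the series that can vanish are
  \<open>\<mu> (1 - c) (1 + a) - z\<close> and \<open>2 \<mu> (1 - c) (1 + a) - z\<close>, at the iterates \<open>z\<close> of \<open>s\<close>.
  At such \<open>s\<close> the series has undefined terms, which the convention \<open>x / 0 = 0\<close> would hide.\<close>

definition terms_defined :: "real \<Rightarrow> real \<Rightarrow> real \<Rightarrow> complex \<Rightarrow> bool" where
  "terms_defined \<mu> a c s \<longleftrightarrow>
     (\<forall>j. (zeta a c ^^ j) s \<noteq> of_real (\<mu> * (1 - c) * (1 + a))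
        \<and> (zeta a c ^^ j) s \<noteq> of_real (2 * \<mu> * (1 - c) * (1 + a)))"

end

theory Submission
  imports Defs
begin

text \<open>
  Conditioning on the first gain gives \<open>R = e + K R\<close> with \<open>e x = exp (- lam (1 - c) x)\<close> and \<open>K\<close> the
  transition operator killed at ruin.  The copula density is a combination of four products of
  exponential densities, so the Laplace transform turns this into
  \<open>\<rho> s = H s + J s * \<rho> (\<zeta> s)\<close>, and iterating yields the series up to the remainder
  \<open>(\<Prod>j<n. J (\<zeta>^j s)) * \<rho> (\<zeta>^n s)\<close>.  Write \<open>r = (1 - c) (1 + a)\<close>.  For \<open>r < 1\<close> the iterates tend
  to infinity, where \<open>J\<close> vanishes.  For \<open>r > 1\<close> they tend to \<open>0\<close> and the product is
  \<open>O (1 / r^n)\<close>, while \<open>\<rho> (\<zeta>^n s) = o (r^n)\<close> because \<open>R x\<close> tends to \<open>0\<close>: ruin from \<open>x\<close> forces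
  \<open>\<Sum>n. B n / r^n \<ge> (1 - c) x\<close>.

  Uniqueness of the two unknowns is proved by duality.  If the \<open>2 \<times> 2\<close> system were singular, a left
  null vector would annihilate the series \<open>\<Sum>k. (\<Prod>j<k. J (\<zeta>^j s)) * F (\<zeta>^k s)\<close>
  at \<open>s = \<mu>, 2 \<mu>\<close> for every forcing \<open>f\<close> with transform \<open>F\<close> for which \<open>u = f + K u\<close> is solvable.
  Every \<open>f\<close> with \<open>\<bar>f\<bar> \<le> M e\<close> qualifies, as the Neumann series is dominated by \<open>M R\<close>;
  forcings whose transforms contain high powers of \<open>exp (- s)\<close> (if \<open>r < 1\<close>) or \<open>1 - exp (- s)\<close>
  (if \<open>r > 1\<close>) isolate the leading terms and show that the null vector is zero.
\<close>


section \<open>Laplace transforms\<close>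

lemma integrable_exp_minus_Ici:
  fixes \<sigma> :: real
  assumes "\<sigma> > 0"
  shows "integrable lborel (\<lambda>x. indicator {0..} x * exp (- \<sigma> * x))"
    and "(\<integral>x. indicator {0..} x * exp (- \<sigma> * x) \<partial>lborel) = 1 / \<sigma>"
proof -
  interpret E: prob_space "density lborel (exponential_density \<sigma>)"
    using assms by (rule prob_space_exponential_density)
  have nn: "0 \<le> exponential_density \<sigma> x" for x
    using assms by (rule exponential_density_nonneg)
  have eq: "indicator {0..} x * exp (- \<sigma> * x) = exponential_density \<sigma> x / \<sigma>" for x
    using assms by (auto simp: exponential_density_def indicator_def field_simps)
  have "integrable (density lborel (exponential_density \<sigma>)) (\<lambda>x. 1 :: real)"
    by simp
  then have int: "integrable lborel (exponential_density \<sigma>)"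
    using nn by (subst (asm) integrable_density) auto
  have "(\<integral>x. 1 \<partial>density lborel (exponential_density \<sigma>)) = (1::real)"
    using E.prob_space by simp
  then have "(\<integral>x. exponential_density \<sigma> x \<partial>lborel) = 1"
    using nn by (subst (asm) integral_density) auto
  then show "integrable lborel (\<lambda>x. indicator {0..} x * exp (- \<sigma> * x))"
    and "(\<integral>x. indicator {0..} x * exp (- \<sigma> * x) \<partial>lborel) = 1 / \<sigma>"
    unfolding eq using int by simp_all
qed

lemma laplace_transform_integrable:
  fixes u :: "real \<Rightarrow> real"
  assumes [measurable]: "u \<in> borel_measurable borel" and s: "Re s > 0"
    and u: "\<And>x. x \<ge> 0 \<Longrightarrow> \<bar>u x\<bar> \<le> M"
  shows "integrable lborel (\<lambda>x. indicator {0..} x *\<^sub>R (exp (- s * of_real x) * complex_of_real (u x)))"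
proof (rule Bochner_Integration.integrable_bound)
  show "integrable lborel (\<lambda>x. M * (indicator {0..} x * exp (- Re s * x)))"
    using integrable_exp_minus_Ici(1)[OF s] by (rule integrable_mult_right)
  show "AE x in lborel. norm (indicator {0..} x *\<^sub>R (exp (- s * of_real x) * complex_of_real (u x)))
      \<le> norm (M * (indicator {0..} x * exp (- Re s * x)))"
  proof (rule AE_I2)
    fix x :: real
    have "x \<ge> 0 \<Longrightarrow> \<bar>u x\<bar> * exp (- Re s * x) \<le> \<bar>M\<bar> * exp (- Re s * x)"
      using u[of x] by (intro mult_right_mono) auto
    then show "norm (indicator {0..} x *\<^sub>R (exp (- s * of_real x) * complex_of_real (u x)))
      \<le> norm (M * (indicator {0..} x * exp (- Re s * x)))"
      by (auto simp: norm_mult abs_mult indicator_def mult.commute)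
  qed
qed measurable

lemma laplace_transform_bound:
  fixes u :: "real \<Rightarrow> real"
  assumes [measurable]: "u \<in> borel_measurable borel" and s: "Re s > 0"
    and u: "\<And>x. x \<ge> 0 \<Longrightarrow> \<bar>u x\<bar> \<le> M"
  shows "norm (laplace_transform u s) \<le> M / Re s"
proof -
  have "norm (laplace_transform u s)
      \<le> (\<integral>x. M * (indicator {0..} x * exp (- Re s * x)) \<partial>lborel)"
    unfolding laplace_transform_def set_lebesgue_integral_def
  proof (rule Bochner_Integration.integral_norm_bound_integral)
    show "integrable lborel (\<lambda>x. indicator {0..} x *\<^sub>R (exp (- s * of_real x) * complex_of_real (u x)))"
      by (rule laplace_transform_integrable) (use assms in auto)
    show "integrable lborel (\<lambda>x. M * (indicator {0..} x * exp (- Re s * x)))"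
      using integrable_exp_minus_Ici(1)[OF s] by (rule integrable_mult_right)
    fix x :: real
    show "norm (indicator {0..} x *\<^sub>R (exp (- s * of_real x) * complex_of_real (u x)))
      \<le> M * (indicator {0..} x * exp (- Re s * x))"
      using u[of x] by (auto simp: norm_mult indicator_def mult.commute intro!: mult_right_mono)
  qed
  also have "\<dots> = M / Re s"
    using integrable_exp_minus_Ici(2)[OF s] by simp
  finally show ?thesis .
qed

lemma laplace_transform_one:
  assumes s: "Re s > 0"
  shows "laplace_transform (\<lambda>_. 1) s = 1 / s"
proof -
  let ?f = "\<lambda>x. exp (- s * of_real x)"
  let ?F = "\<lambda>x::real. - exp (- s * of_real x) / s"
  have s0: "s \<noteq> 0" using s by auto
  have ne: "einterval 0 \<infinity> = {0<..}"
    by (auto simp: einterval_def)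
  have int: "integrable lborel (\<lambda>x. indicator {0..} x *\<^sub>R ?f x)"
    using laplace_transform_integrable[of "\<lambda>_. 1" s 1] s by simp
  have seti: "set_integrable lborel (einterval 0 \<infinity>) ?f"
    unfolding ne
    by (rule set_integrable_subset[of _ "{0..}"]) (use int in \<open>auto simp: set_integrable_def\<close>)
  have "(LBINT x=0..\<infinity>. ?f x) = 0 - (- 1 / s)"
  proof (rule interval_integral_FTC_integrable[where F = ?F])
    show "(?F has_vector_derivative ?f x) (at x)" for x
      unfolding has_vector_derivative_def has_field_derivative_def[symmetric] using s0
      by (auto intro!: derivative_eq_intros has_vector_derivative_real_field simp flip: has_vector_derivative_def)
    show "isCont ?f x" for x by (intro continuous_intros)
    show "((?F \<circ> real_of_ereal) \<longlongrightarrow> - 1 / s) (at_right 0)"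
      unfolding zero_ereal_def ereal_tendsto_simps
      by (rule tendsto_eq_intros refl | use s0 in simp)+
    have "((\<lambda>x::real. exp (- s * of_real x)) \<longlongrightarrow> 0) at_top"
    proof (rule tendsto_norm_zero_cancel)
      have "((\<lambda>x. exp (- (Re s * x))) \<longlongrightarrow> 0) at_top"
        using s by (intro filterlim_compose[OF exp_at_bot] filterlim_compose[OF filterlim_uminus_at_bot_at_top] filterlim_tendsto_pos_mult_at_top[OF tendsto_const s filterlim_ident])
      then show "((\<lambda>x::real. norm (exp (- s * of_real x))) \<longlongrightarrow> 0) at_top"
        by simp
    qed
    from tendsto_divide[OF tendsto_minus[OF this] tendsto_const[of s] s0]
    show "((?F \<circ> real_of_ereal) \<longlongrightarrow> 0) (at_left \<infinity>)"
      unfolding ereal_tendsto_simps by simp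
  qed (use seti in auto)
  moreover have "(LBINT x=0..\<infinity>. ?f x) = (LBINT x:{0<..}. ?f x)"
    unfolding interval_lebesgue_integral_def ne by simp
  \<comment> \<open>The transform integrates over the closed half-line; the endpoint is a null
    set.\<close>
  moreover have "(LBINT x:{0<..}. ?f x) = (LBINT x:{0..}. ?f x)"
    unfolding set_lebesgue_integral_def
    by (rule integral_cong_AE) (use AE_lborel_singleton[of 0] in \<open>auto simp: indicator_def\<close>)
  ultimately show ?thesis
    by (simp add: laplace_transform_def)
qed

lemma laplace_transform_exp:
  assumes s: "Re s > - \<sigma>"
  shows "laplace_transform (\<lambda>x. exp (- \<sigma> * x)) s = 1 / (s + of_real \<sigma>)"
proof -
  have "laplace_transform (\<lambda>x. exp (- \<sigma> * x)) s = laplace_transform (\<lambda>_. 1) (s + of_real \<sigma>)"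
    unfolding laplace_transform_def
    by (simp add: exp_of_real[symmetric] exp_add[symmetric] algebra_simps)
  then show ?thesis
    using laplace_transform_one[of "s + of_real \<sigma>"] s by simp
qed

lemma has_vector_derivative_exp_cmult:
  fixes z :: complex
  assumes "z \<noteq> 0"
  shows "((\<lambda>x::real. exp (z * of_real x) / z) has_vector_derivative exp (z * of_real x)) (at x within S)"
  using assms
  by (auto intro!: derivative_eq_intros has_vector_derivative_real_field)

lemma integral_exp_Icc:
  fixes z :: complex
  assumes "z \<noteq> 0" "0 \<le> w"
  shows "(\<integral>y. indicator {0..w} y *\<^sub>R exp (z * of_real y) \<partial>lborel) = (exp (z * of_real w) - 1) / z"
proof -
  have "has_bochner_integral lborel (\<lambda>y. indicator {0..w} y *\<^sub>R exp (z * of_real y))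
     (exp (z * of_real w) / z - exp (z * of_real 0) / z)"
    using assms by (intro has_bochner_integral_FTC_Icc)
      (auto intro!: has_vector_derivative_exp_cmult continuous_intros)
  then show ?thesis
    by (simp add: has_bochner_integral_integral_eq diff_divide_distrib)
qed

lemma lborel_integral_product:
  fixes f g :: "real \<Rightarrow> complex"
  assumes f: "integrable lborel f" and g: "integrable lborel g"
  shows "integrable (lborel \<Otimes>\<^sub>M lborel) (\<lambda>p. f (fst p) * g (snd p))"
    and "(\<integral>p. f (fst p) * g (snd p) \<partial>(lborel \<Otimes>\<^sub>M lborel)) = (\<integral>x. f x \<partial>lborel) * (\<integral>y. g y \<partial>lborel)"
proof -
  have [measurable]: "f \<in> borel_measurable borel" "g \<in> borel_measurable borel"
    using f g by (auto dest: borel_measurable_integrable)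
  show int: "integrable (lborel \<Otimes>\<^sub>M lborel) (\<lambda>p. f (fst p) * g (snd p))"
    by (rule lborel_pair.Fubini_integrable) (use f g in \<open>auto simp: norm_mult\<close>)
  show "(\<integral>p. f (fst p) * g (snd p) \<partial>(lborel \<Otimes>\<^sub>M lborel)) = (\<integral>x. f x \<partial>lborel) * (\<integral>y. g y \<partial>lborel)"
    using lborel_pair.integral_fst'[OF int] by simp
qed

section \<open>Averages against exponential densities\<close>

lemma integrable_exponential_density:
  assumes "0 < l"
  shows "integrable lborel (exponential_density l)"
    and "(\<integral>x. exponential_density l x \<partial>lborel) = 1"
proof -
  have eq: "exponential_density l = (\<lambda>x. l * (indicator {0..} x * exp (- l * x)))"
    by (auto simp: exponential_density_def indicator_def fun_eq_iff)
  show "integrable lborel (exponential_density l)"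
    unfolding eq by (rule integrable_mult_right[OF integrable_exp_minus_Ici(1)[OF assms]])
  show "(\<integral>x. exponential_density l x \<partial>lborel) = 1"
    unfolding eq using integrable_exp_minus_Ici(2)[OF assms] assms by simp
qed

lemma integrable_exponential_density_bounded:
  fixes \<phi> :: "real \<Rightarrow> complex"
  assumes l: "0 < l" and [measurable]: "\<phi> \<in> borel_measurable borel"
    and \<phi>: "\<And>x. 0 \<le> x \<Longrightarrow> norm (\<phi> x) \<le> M"
  shows "integrable lborel (\<lambda>x. exponential_density l x *\<^sub>R \<phi> x)"
proof (rule Bochner_Integration.integrable_bound)
  show "integrable lborel (\<lambda>x. M * exponential_density l x)"
    using integrable_exponential_density(1)[OF l] by (rule integrable_mult_right)
  show "AE x in lborel. norm (exponential_density l x *\<^sub>R \<phi> x) \<le> norm (M * exponential_density l x)"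
  proof (rule AE_I2)
    fix x
    show "norm (exponential_density l x *\<^sub>R \<phi> x) \<le> norm (M * exponential_density l x)"
    proof (cases "x < 0")
      case False
      then have "norm (\<phi> x) \<le> \<bar>M\<bar>" using \<phi>[of x] by simp
      then show ?thesis
        by (simp add: abs_mult mult.commute mult_right_mono)
    qed (simp add: exponential_density_def)
  qed
qed measurable

lemma exponential_density_laplace:
  fixes s :: complex
  assumes l: "0 < l" and s: "Re s \<ge> 0"
  shows "(\<integral>x. exponential_density l x *\<^sub>R exp (- s * of_real x) \<partial>lborel) = of_real l / (of_real l + s)"
proof -
  have "exponential_density l x *\<^sub>R exp (- s * of_real x)
      = of_real l * (indicator {0..} x *\<^sub>R (exp (- s * of_real x) * of_real (exp (- l * x))))" for x :: real
    by (auto simp: exponential_density_def indicator_def scaleR_conv_of_real mult_ac)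
  then have "(\<integral>x. exponential_density l x *\<^sub>R exp (- s * of_real x) \<partial>lborel)
      = of_real l * laplace_transform (\<lambda>x. exp (- l * x)) s"
    unfolding laplace_transform_def set_lebesgue_integral_def by (simp only: integral_mult_right_zero)
  also have "\<dots> = of_real l / (of_real l + s)"
    using laplace_transform_exp[of l s] l s by (simp add: add.commute)
  finally show ?thesis .
qed

text \<open>In the coordinates \<open>w = v + y\<close> the double integral runs over
  \<open>0 \<le> y \<le> w\<close>, and integrating out \<open>y\<close> first leaves a divided
  difference of the transform between \<open>z\<close> and \<open>\<beta>\<close>. This is how the
  values of the transform at the rates of \<open>C\<close> enter.\<close>

lemma exponential_density_laplace_shift:
  fixes u :: "real \<Rightarrow> real"
  assumes [measurable]: "u \<in> borel_measurable borel" and u: "\<And>x. 0 \<le> x \<Longrightarrow> \<bar>u x\<bar> \<le> M"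
    and \<beta>: "0 < \<beta>" and z: "0 < Re z" "z \<noteq> of_real \<beta>"
  shows "(\<integral>y. exponential_density \<beta> y *\<^sub>R laplace_transform (\<lambda>v. u (v + y)) z \<partial>lborel)
       = of_real \<beta> / (of_real \<beta> - z) * (laplace_transform u z - laplace_transform u (of_real \<beta>))"
proof -
  define h where "h y w = (if 0 \<le> y \<and> y \<le> w
      then \<beta> * exp (- \<beta> * y) *\<^sub>R (exp (- z * of_real (w - y)) * complex_of_real (u w)) else 0)" for y w :: real
  have [measurable]: "(\<lambda>p. h (fst p) (snd p)) \<in> borel_measurable (lborel \<Otimes>\<^sub>M lborel)"
    unfolding h_def by measurable
  then have [measurable]: "case_prod h \<in> borel_measurable (lborel \<Otimes>\<^sub>M lborel)"
    by (simp add: case_prod_beta')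
  have inner: "(\<integral>w. h y w \<partial>lborel) = exponential_density \<beta> y *\<^sub>R laplace_transform (\<lambda>v. u (v + y)) z" for y
  proof -
    have "(\<integral>w. h y w \<partial>lborel) = (\<integral>v. h y (y + v) \<partial>lborel)"
      using lborel_integral_real_affine[of 1 "h y" y] by simp
    also have "\<dots> = (\<integral>v. exponential_density \<beta> y *\<^sub>R (indicator {0..} v *\<^sub>R (exp (- z * of_real v) * complex_of_real (u (v + y)))) \<partial>lborel)"
      by (rule Bochner_Integration.integral_cong)
         (auto simp: h_def exponential_density_def indicator_def add.commute mult_ac scaleR_conv_of_real)
    finally show ?thesis
      unfolding laplace_transform_def set_lebesgue_integral_def by (simp only: integral_scaleR_right)
  qed
  define M' where "M' = \<bar>M\<bar>"
  have u': "\<And>x. 0 \<le> x \<Longrightarrow> \<bar>u x\<bar> \<le> M'" using u by (force simp: M'_def)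
  have M'0: "0 \<le> M'" by (simp add: M'_def)
  have norm_h: "norm (h y w) \<le> exponential_density \<beta> y * (M' * (indicator {0..} (w - y) * exp (- Re z * (w - y))))" for y w
    using u'[of w] \<beta> by (auto simp: h_def exponential_density_def norm_mult indicator_def mult.commute intro!: mult_left_mono)
  have shift_int: "integrable lborel (\<lambda>w. indicator {0..} (w - y) * exp (- Re z * (w - y)))"
    and shift_eq: "(\<integral>w. indicator {0..} (w - y) * exp (- Re z * (w - y)) \<partial>lborel) = 1 / Re z" for y :: real
  proof -
    show "integrable lborel (\<lambda>w. indicator {0..} (w - y) * exp (- Re z * (w - y)))"
      using lborel_integrable_real_affine[OF integrable_exp_minus_Ici(1)[OF z(1)], of 1 "- y"] by (simp add: algebra_simps)
    show "(\<integral>w. indicator {0..} (w - y) * exp (- Re z * (w - y)) \<partial>lborel) = 1 / Re z"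
      using lborel_integral_real_affine[of 1 "\<lambda>x. indicator {0..} x * exp (- Re z * x)" "- y"]
        integrable_exp_minus_Ici(2)[OF z(1)] by (simp add: algebra_simps)
  qed
  have int1: "integrable lborel (h y)" for y
    by (rule Bochner_Integration.integrable_bound[OF integrable_mult_right[OF integrable_mult_right[OF shift_int[of y], of M'], of "exponential_density \<beta> y"]])
       (use norm_h in \<open>auto intro!: AE_I2 order_trans[OF _ abs_ge_self]\<close>)
  have int: "integrable (lborel \<Otimes>\<^sub>M lborel) (case_prod h)"
  proof (rule lborel_pair.Fubini_integrable)
    show "integrable lborel (\<lambda>y. \<integral>w. norm (case_prod h (y, w)) \<partial>lborel)"
    proof (rule Bochner_Integration.integrable_bound)
      show "integrable lborel (\<lambda>y. exponential_density \<beta> y * (M' * (1 / Re z)))"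
        by (rule integrable_mult_left[OF integrable_exponential_density(1)[OF \<beta>]])
      show "AE y in lborel. norm (\<integral>w. norm (case_prod h (y, w)) \<partial>lborel)
          \<le> norm (exponential_density \<beta> y * (M' * (1 / Re z)))"
      proof (rule AE_I2)
        fix y
        have "(\<integral>w. norm (h y w) \<partial>lborel)
            \<le> (\<integral>w. exponential_density \<beta> y * (M' * (indicator {0..} (w - y) * exp (- Re z * (w - y)))) \<partial>lborel)"
          using int1[of y] norm_h[of y] shift_int[of y]
          by (intro integral_mono integrable_norm integrable_mult_right) auto
        also have "\<dots> = exponential_density \<beta> y * (M' * (1 / Re z))"
          using shift_eq by simp
        finally have "(\<integral>w. norm (h y w) \<partial>lborel) \<le> \<bar>exponential_density \<beta> y * (M' * (1 / Re z))\<bar>"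
          by (rule order_trans[OF _ abs_ge_self])
        then show "norm (\<integral>w. norm (case_prod h (y, w)) \<partial>lborel)
          \<le> norm (exponential_density \<beta> y * (M' * (1 / Re z)))"
          by simp
      qed
    qed measurable
  qed (use int1 in \<open>auto simp: case_prod_beta'\<close>)
  have swap: "(\<integral>y. \<integral>w. h y w \<partial>lborel \<partial>lborel) = (\<integral>w. \<integral>y. h y w \<partial>lborel \<partial>lborel)"
    using lborel_pair.Fubini_integral[OF int] by simp
  \<comment> \<open>Integrating \<open>exp ((z - \<beta>) y)\<close> over \<open>[0, w]\<close>
    divides by \<open>z - \<beta>\<close>, hence the hypothesis
    \<open>z \<noteq> of_real \<beta>\<close>.\<close>
  have inner2: "(\<integral>y. h y w \<partial>lborel) = of_real \<beta> / (of_real \<beta> - z) *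
      (indicator {0..} w *\<^sub>R (exp (- z * of_real w) * complex_of_real (u w))
       - indicator {0..} w *\<^sub>R (exp (- of_real \<beta> * of_real w) * complex_of_real (u w)))" for w
  proof (cases "0 \<le> w")
    case True
    have nz: "z - of_real \<beta> \<noteq> 0" using z by simp
    have "h y w = (of_real \<beta> * exp (- z * of_real w) * of_real (u w)) *
        (indicator {0..w} y *\<^sub>R exp ((z - of_real \<beta>) * of_real y))" for y
      by (auto simp: h_def indicator_def scaleR_conv_of_real exp_of_real[symmetric] exp_add[symmetric] algebra_simps simp flip: exp_add)
    then have "(\<integral>y. h y w \<partial>lborel) = (of_real \<beta> * exp (- z * of_real w) * of_real (u w)) *
        ((exp ((z - of_real \<beta>) * of_real w) - 1) / (z - of_real \<beta>))"
      using integral_exp_Icc[OF nz True] by (simp only: integral_mult_right_zero)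
    also have "\<dots> = of_real \<beta> / (of_real \<beta> - z) * ((exp (- z * of_real w) - exp (- z * of_real w) * exp ((z - of_real \<beta>) * of_real w)) * of_real (u w))"
      using nz z by (simp add: divide_simps) (simp add: algebra_simps)
    also have "exp (- z * of_real w) * exp ((z - of_real \<beta>) * of_real w) = exp (- of_real \<beta> * of_real w)"
      by (simp add: algebra_simps flip: exp_add)
    finally show ?thesis using True by (simp add: algebra_simps)
  qed (auto simp: h_def intro!: integral_eq_zero_AE)
  have "(\<integral>y. exponential_density \<beta> y *\<^sub>R laplace_transform (\<lambda>v. u (v + y)) z \<partial>lborel) = (\<integral>w. \<integral>y. h y w \<partial>lborel \<partial>lborel)"
    using swap by (simp add: inner)
  also have "\<dots> = of_real \<beta> / (of_real \<beta> - z) * (laplace_transform u z - laplace_transform u (of_real \<beta>))"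
    unfolding inner2 laplace_transform_def set_lebesgue_integral_def
    using laplace_transform_integrable[OF assms(1) z(1) u] laplace_transform_integrable[OF assms(1), of "of_real \<beta>", OF _ u] \<beta>
    by (subst integral_mult_right_zero, subst Bochner_Integration.integral_diff) auto
  finally show ?thesis .
qed

section \<open>The law of a gain and the killed transition operator\<close>

locale fgm_dual_risk =
  fixes lam \<mu> a c \<theta> :: real
  assumes lam: "0 < lam" and mu: "0 < \<mu>" and a: "0 \<le> a" and c: "0 < c" "c < 1"
    and theta: "-1 \<le> \<theta>" "\<theta> \<le> 1"
begin

definition d :: real where "d = 1 - c"
definition g :: real where "g = 1 + a"
text \<open>A cycle with \<open>b = 0\<close> and \<open>y = 0\<close> multiplies the level by
  \<open>r\<close>. Whether \<open>r\<close> exceeds 1 decides if the iterates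
  \<open>s / r^k\<close> shrink or grow.\<close>

definition r :: real where "r = d * g"
definition N :: "(real \<times> real) measure" where
  "N = density lborel (\<lambda>z. ennreal (fgm_exp_density lam \<mu> \<theta> z))"

lemma pos: "0 < d" "0 < g" "0 < r"
  using a c by (auto simp: d_def g_def r_def)

lemma sets_N [measurable_cong, simp]: "sets N = sets borel"
  by (simp add: N_def)

lemma space_N [simp]: "space N = UNIV"
  by (simp add: N_def)

text \<open>The copula factor is expanded so that every integral against \<open>N\<close> becomes a
  signed combination of four products of one-dimensional integrals. The weights
  \<open>1 + \<theta>\<close>, \<open>- \<theta>\<close>, \<open>- \<theta>\<close>,
  \<open>\<theta>\<close> sum to 1 but may be negative, so the sign of the density is a separate
  matter.\<close>

lemma fgm_eq_exponential_densities:
  "fgm_exp_density lam \<mu> \<theta> z =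
     (1 + \<theta>) * (exponential_density lam (fst z) * exponential_density \<mu> (snd z))
     - \<theta> * (exponential_density (2 * lam) (fst z) * exponential_density \<mu> (snd z))
     - \<theta> * (exponential_density lam (fst z) * exponential_density (2 * \<mu>) (snd z))
     + \<theta> * (exponential_density (2 * lam) (fst z) * exponential_density (2 * \<mu>) (snd z))"
  by (auto simp: fgm_exp_density_def exponential_density_def algebra_simps split: prod.splits)

lemma measurable_fgm [measurable]: "fgm_exp_density lam \<mu> \<theta> \<in> borel_measurable borel"
proof -
  have "(\<lambda>z. fgm_exp_density lam \<mu> \<theta> z) \<in> borel_measurable (borel \<Otimes>\<^sub>M borel)"
    unfolding fgm_eq_exponential_densities by measurable
  then show ?thesis by (simp add: borel_prod)
qed

text \<open>With the survival probabilities \<open>E\<close> and \<open>F\<close> in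
  \<open>(0, 1]\<close> the density is the product density times
  \<open>1 + \<theta> (2 E - 1) (2 F - 1)\<close>, and each of the three factors behind the plus
  sign has modulus at most 1.\<close>

lemma fgm_nonneg: "0 \<le> fgm_exp_density lam \<mu> \<theta> z"
proof (cases "fst z < 0 \<or> snd z < 0")
  case False
  define E F where "E = exp (- lam * fst z)" and "F = exp (- \<mu> * snd z)"
  define p q where "p = 2 * E - 1" and "q = 2 * F - 1"
  have "E \<le> 1" "F \<le> 1"
    using False lam mu by (auto simp: E_def F_def)
  moreover have "0 < E" "0 < F" by (simp_all add: E_def F_def)
  ultimately have "\<bar>p\<bar> \<le> 1" "\<bar>q\<bar> \<le> 1"
    unfolding p_def q_def by linarith+
  then have "\<bar>p * q\<bar> \<le> 1"
    by (simp add: abs_mult mult_le_one)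
  then have "\<bar>\<theta> * (p * q)\<bar> \<le> 1"
    unfolding abs_mult[of \<theta>] using theta by (intro mult_le_one) auto
  then have "0 \<le> 1 + \<theta> * (p * q)" by linarith
  moreover have "fgm_exp_density lam \<mu> \<theta> z = lam * E * (\<mu> * F) * (1 + \<theta> * (p * q))"
  proof -
    have "exp (- 2 * lam * fst z) = E * E" "exp (- 2 * \<mu> * snd z) = F * F"
      by (simp_all add: E_def F_def flip: exp_add)
    then have "fgm_exp_density lam \<mu> \<theta> z
        = lam * E * (\<mu> * F) + \<theta> * (2 * lam * (E * E) - lam * E) * (2 * \<mu> * (F * F) - \<mu> * F)"
      using False by (simp add: fgm_exp_density_def case_prod_beta' E_def F_def)
    then show ?thesis
      by (simp add: p_def q_def algebra_simps)
  qed
  ultimately show ?thesis using lam mu \<open>0 < E\<close> \<open>0 < F\<close> by simp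
qed (auto simp: fgm_exp_density_def split: prod.splits)

lemma integral_N_product:
  fixes \<phi> \<psi> :: "real \<Rightarrow> complex"
  assumes [measurable]: "\<phi> \<in> borel_measurable borel" "\<psi> \<in> borel_measurable borel"
    and \<phi>: "\<And>l. 0 < l \<Longrightarrow> integrable lborel (\<lambda>x. exponential_density l x *\<^sub>R \<phi> x)"
    and \<psi>: "\<And>l. 0 < l \<Longrightarrow> integrable lborel (\<lambda>x. exponential_density l x *\<^sub>R \<psi> x)"
  defines "A \<equiv> \<lambda>l. \<integral>x. exponential_density l x *\<^sub>R \<phi> x \<partial>lborel"
    and "B \<equiv> \<lambda>l. \<integral>x. exponential_density l x *\<^sub>R \<psi> x \<partial>lborel"
  shows "integrable N (\<lambda>z. \<phi> (fst z) * \<psi> (snd z))"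
    and "(\<integral>z. \<phi> (fst z) * \<psi> (snd z) \<partial>N) =
      (1 + of_real \<theta>) * (A lam * B \<mu>) - of_real \<theta> * (A (2 * lam) * B \<mu>)
      - of_real \<theta> * (A lam * B (2 * \<mu>)) + of_real \<theta> * (A (2 * lam) * B (2 * \<mu>))"
proof -
  define T where "T l m z = (exponential_density l (fst z) *\<^sub>R \<phi> (fst z)) * (exponential_density m (snd z) *\<^sub>R \<psi> (snd z))"
    for l m and z :: "real \<times> real"
  have T_int: "integrable lborel (T l m)" and T_eq: "(\<integral>z. T l m z \<partial>lborel) = A l * B m" if "0 < l" "0 < m" for l m
    using lborel_integral_product[OF \<phi>[OF that(1)] \<psi>[OF that(2)]]
    unfolding T_def A_def B_def lborel_prod by auto
  have [measurable]: "(\<lambda>z. \<phi> (fst z) * \<psi> (snd z)) \<in> borel_measurable borel"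
  proof -
    have "(\<lambda>z. \<phi> (fst z) * \<psi> (snd z)) \<in> borel_measurable (borel \<Otimes>\<^sub>M borel)" by measurable
    then show ?thesis by (simp add: borel_prod)
  qed
  have eq: "fgm_exp_density lam \<mu> \<theta> z *\<^sub>R (\<phi> (fst z) * \<psi> (snd z)) =
      (1 + of_real \<theta>) * T lam \<mu> z - of_real \<theta> * T (2 * lam) \<mu> z
      - of_real \<theta> * T lam (2 * \<mu>) z + of_real \<theta> * T (2 * lam) (2 * \<mu>) z" for z
    unfolding fgm_eq_exponential_densities T_def by (simp add: scaleR_conv_of_real algebra_simps)
  have int: "integrable lborel (\<lambda>z. fgm_exp_density lam \<mu> \<theta> z *\<^sub>R (\<phi> (fst z) * \<psi> (snd z)))"
    unfolding eq using lam mu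
    by (intro Bochner_Integration.integrable_add Bochner_Integration.integrable_diff integrable_mult_right T_int) auto
  show "integrable N (\<lambda>z. \<phi> (fst z) * \<psi> (snd z))"
    unfolding N_def using int fgm_nonneg by (subst integrable_density) auto
  have "(\<integral>z. \<phi> (fst z) * \<psi> (snd z) \<partial>N) = (\<integral>z. fgm_exp_density lam \<mu> \<theta> z *\<^sub>R (\<phi> (fst z) * \<psi> (snd z)) \<partial>lborel)"
    unfolding N_def using fgm_nonneg by (subst integral_density) auto
  also have "\<dots> = (1 + of_real \<theta>) * (A lam * B \<mu>) - of_real \<theta> * (A (2 * lam) * B \<mu>)
      - of_real \<theta> * (A lam * B (2 * \<mu>)) + of_real \<theta> * (A (2 * lam) * B (2 * \<mu>))"
    unfolding eq using lam mu T_int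
    by (simp add: T_eq)
  finally show "(\<integral>z. \<phi> (fst z) * \<psi> (snd z) \<partial>N) =
      (1 + of_real \<theta>) * (A lam * B \<mu>) - of_real \<theta> * (A (2 * lam) * B \<mu>)
      - of_real \<theta> * (A lam * B (2 * \<mu>)) + of_real \<theta> * (A (2 * lam) * B (2 * \<mu>))" .
qed

text \<open>With second factor 1 the four weights collapse to a single term: the first marginal is
  exponential with rate \<open>lam\<close> for every \<open>\<theta>\<close>.\<close>

lemma integral_N_fst:
  fixes \<phi> :: "real \<Rightarrow> complex"
  assumes [measurable]: "\<phi> \<in> borel_measurable borel"
    and \<phi>: "\<And>l. 0 < l \<Longrightarrow> integrable lborel (\<lambda>x. exponential_density l x *\<^sub>R \<phi> x)"
  shows "integrable N (\<lambda>z. \<phi> (fst z))"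
    and "(\<integral>z. \<phi> (fst z) \<partial>N) = (\<integral>x. exponential_density lam x *\<^sub>R \<phi> x \<partial>lborel)"
proof -
  have i1: "integrable lborel (\<lambda>x. exponential_density l x *\<^sub>R (1::complex))" if "0 < l" for l
    using integrable_exponential_density(1)[OF that] by (rule integrable_scaleR_left)
  have e1: "(\<integral>x. exponential_density l x *\<^sub>R (1::complex) \<partial>lborel) = 1" if "0 < l" for l
    using integrable_exponential_density[OF that] by (subst integral_scaleR_left) auto
  show "integrable N (\<lambda>z. \<phi> (fst z))"
    using integral_N_product(1)[of \<phi> "\<lambda>_. 1", OF _ _ \<phi> i1] by simp
  show "(\<integral>z. \<phi> (fst z) \<partial>N) = (\<integral>x. exponential_density lam x *\<^sub>R \<phi> x \<partial>lborel)"
    using integral_N_product(2)[of \<phi> "\<lambda>_. 1", OF _ _ \<phi> i1] e1[of \<mu>] e1[of "2*\<mu>"] mu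
    by (simp add: algebra_simps)
qed

lemma prob_space_N: "prob_space N"
proof
  have i1: "integrable lborel (\<lambda>x. exponential_density l x *\<^sub>R (1::complex))" if "0 < l" for l
    using integrable_exponential_density(1)[OF that] by (rule integrable_scaleR_left)
  have "integrable N (\<lambda>z. complex_of_real 1)"
    using integral_N_fst(1)[of "\<lambda>_. 1"] i1 by simp
  then have int: "integrable N (\<lambda>z. 1 :: real)"
    by (simp only: complex_of_real_integrable_eq)
  have "complex_of_real (\<integral>z. 1 \<partial>N) = (\<integral>z. 1 \<partial>N)"
    by (simp add: scaleR_conv_of_real)
  also have "\<dots> = 1"
    using integral_N_fst(2)[of "\<lambda>_. 1"] i1 integrable_exponential_density[OF lam]
    by (simp add: integral_scaleR_left)
  finally have "(\<integral>z. 1 \<partial>N) = (1 :: real)"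
    by (simp only: of_real_eq_1_iff)
  then show "emeasure N (space N) = 1"
    using nn_integral_eq_integral[OF int] by simp
qed

sublocale N: prob_space N
  by (rule prob_space_N)

lemma AE_N_nonneg: "AE z in N. 0 \<le> fst z \<and> 0 \<le> snd z"
proof -
  have "0 < fgm_exp_density lam \<mu> \<theta> z \<Longrightarrow> 0 \<le> fst z \<and> 0 \<le> snd z" for z
    by (auto simp: fgm_exp_density_def split: prod.splits if_splits)
  then show ?thesis
    unfolding N_def by (subst AE_density) auto
qed

lemma prob_interarrival_ge:
  assumes "0 \<le> t"
  shows "measure N {z. t \<le> fst z} = exp (- lam * t)"
proof -
  have [measurable]: "(\<lambda>z. fst z :: real) \<in> borel_measurable N"
    by (simp add: borel_prod[symmetric] cong: measurable_cong_sets)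
  have bd: "integrable lborel (\<lambda>x. exponential_density l x *\<^sub>R complex_of_real (indicator {t..} x))" if "0 < l" for l
    using that by (intro integrable_exponential_density_bounded[where M = 1]) (auto simp: indicator_def)
  have "complex_of_real (measure N {z. t \<le> fst z}) = (\<integral>z. complex_of_real (indicator {z. t \<le> fst z} z) \<partial>N)"
    by simp
  also have "\<dots> = (\<integral>z. complex_of_real (indicator {t..} (fst z)) \<partial>N)"
    by (intro Bochner_Integration.integral_cong) (auto simp: indicator_def)
  also have "\<dots> = (\<integral>x. exponential_density lam x *\<^sub>R complex_of_real (indicator {t..} x) \<partial>lborel)"
    by (rule integral_N_fst(2)) (use bd in auto)
  also have "\<dots> = complex_of_real (\<integral>x. exponential_density lam x * indicator {t..} x \<partial>lborel)"
    by (subst integral_complex_of_real[symmetric]) (simp add: scaleR_conv_of_real)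
  \<comment> \<open>Translating by \<open>t\<close> turns the tail into \<open>exp (- lam t)\<close>
    times the whole density, which has mass 1.\<close>
  also have "(\<integral>x. exponential_density lam x * indicator {t..} x \<partial>lborel)
      = (\<integral>x. exponential_density lam (t + x) * indicator {t..} (t + x) \<partial>lborel)"
    using lborel_integral_real_affine[of 1 "\<lambda>x. exponential_density lam x * indicator {t..} x" t] by simp
  also have "\<dots> = (\<integral>x. exp (- lam * t) * exponential_density lam x \<partial>lborel)"
    using assms by (intro Bochner_Integration.integral_cong) (auto simp: exponential_density_def indicator_def ring_distribs mult_exp_exp mult_ac add_ac)
  also have "\<dots> = exp (- lam * t)"
    using integrable_exponential_density[OF lam] by simp
  finally show ?thesis by (simp only: of_real_eq_iff)
qed

text \<open>The finite mean of \<open>B\<close> is what bounds the expected discounted sum in the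
  proof that ruin becomes unlikely from high levels.\<close>

lemma nn_integral_interarrival_finite: "(\<integral>\<^sup>+z. ennreal (fst z) \<partial>N) < \<infinity>"
proof -
  have int: "integrable lborel (\<lambda>x. exponential_density l x *\<^sub>R complex_of_real x)" if l: "0 < l" for l
  proof (rule Bochner_Integration.integrable_bound)
    show "integrable lborel (\<lambda>x. 2 * (indicator {0..} x * exp (- (l / 2) * x)))"
      using integrable_exp_minus_Ici(1)[of "l / 2"] l by (intro integrable_mult_right) auto
    show "AE x in lborel. norm (exponential_density l x *\<^sub>R complex_of_real x)
        \<le> norm (2 * (indicator {0..} x * exp (- (l / 2) * x)))"
    proof (rule AE_I2)
      fix x :: real
      \<comment> \<open>Half of the exponential decay pays for the factor \<open>x\<close>.\<close>
      have "l * x \<le> 2 * exp (l / 2 * x)"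
        using exp_ge_add_one_self[of "l / 2 * x"] by linarith
      then have "l * x * exp (- l * x) \<le> 2 * exp (l / 2 * x) * exp (- l * x)"
        by (intro mult_right_mono) auto
      also have "\<dots> = 2 * exp (- (l / 2) * x)"
        by (simp flip: exp_add)
      finally show "norm (exponential_density l x *\<^sub>R complex_of_real x)
        \<le> norm (2 * (indicator {0..} x * exp (- (l / 2) * x)))"
        using l by (auto simp: exponential_density_def indicator_def algebra_simps)
    qed
  qed measurable
  have "integrable N (\<lambda>z. complex_of_real (fst z))"
    by (rule integral_N_fst(1)[OF _ int]) auto
  then have "integrable N (\<lambda>z. fst z :: real)"
    by (simp add: complex_of_real_integrable_eq)
  then have fin: "(\<integral>\<^sup>+z. ennreal (norm (fst z)) \<partial>N) < \<infinity>"
    by (simp only: integrable_iff_bounded)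
  have "(\<integral>\<^sup>+z. ennreal (fst z) \<partial>N) \<le> (\<integral>\<^sup>+z. ennreal (norm (fst z)) \<partial>N)"
    by (auto intro!: nn_integral_mono ennreal_leI)
  then show ?thesis
    using fin by (rule le_less_trans)
qed


section \<open>The transition operator killed at ruin\<close>

text \<open>Just before the gain the surplus is \<open>x - (c x + b) = d x - b\<close>, so
  \<open>b < d x\<close> says that the gain comes before ruin. The sign conditions on
  \<open>b\<close> and \<open>y\<close> keep the argument of \<open>u\<close> nonnegative, so bounds
  for \<open>u\<close> on the nonnegative half-line carry over pointwise.\<close>

definition gain_kernel :: "(real \<Rightarrow> real) \<Rightarrow> real \<Rightarrow> real \<times> real \<Rightarrow> real" where
  "gain_kernel u x z = (if 0 \<le> fst z \<and> fst z < d * x \<and> 0 \<le> snd z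
     then u (g * (d * x - fst z) + snd z) else 0)"

definition gain_op :: "(real \<Rightarrow> real) \<Rightarrow> real \<Rightarrow> real" where
  "gain_op u x = (\<integral>z. gain_kernel u x z \<partial>N)"

lemma measurable_gain_kernel [measurable]:
  assumes [measurable]: "u \<in> borel_measurable borel"
  shows "(\<lambda>p. gain_kernel u (fst p) (snd p)) \<in> borel_measurable (borel \<Otimes>\<^sub>M N)"
    and "gain_kernel u x \<in> borel_measurable N"
proof -
  have "(\<lambda>p. gain_kernel u (fst p) (snd p)) \<in> borel_measurable (borel \<Otimes>\<^sub>M (borel \<Otimes>\<^sub>M borel))"
    unfolding gain_kernel_def by measurable
  moreover have sets: "sets (borel \<Otimes>\<^sub>M N :: (real \<times> real \<times> real) measure) = sets (borel \<Otimes>\<^sub>M (borel \<Otimes>\<^sub>M borel))"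
    by (rule sets_pair_measure_cong) (simp_all only: borel_prod sets_N)
  ultimately show 1: "(\<lambda>p. gain_kernel u (fst p) (snd p)) \<in> borel_measurable (borel \<Otimes>\<^sub>M N)"
    using sets by (simp only: measurable_cong_sets[OF sets refl])
  show "gain_kernel u x \<in> borel_measurable N"
    using measurable_compose[OF measurable_Pair1' 1, of x] by simp
qed

lemma measurable_gain_op [measurable]:
  assumes [measurable]: "u \<in> borel_measurable borel"
  shows "gain_op u \<in> borel_measurable borel"
  unfolding gain_op_def[abs_def]
  by (rule N.borel_measurable_lebesgue_integral) (simp add: case_prod_beta' assms)

lemma gain_kernel_bound:
  assumes "\<And>x. 0 \<le> x \<Longrightarrow> \<bar>u x\<bar> \<le> M"
  shows "\<bar>gain_kernel u x z\<bar> \<le> \<bar>M\<bar>"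
proof (cases "0 \<le> fst z \<and> fst z < d * x \<and> 0 \<le> snd z")
  case True
  then have "0 \<le> g * (d * x - fst z) + snd z"
    using pos by (intro add_nonneg_nonneg mult_nonneg_nonneg) auto
  from assms[OF this] True show ?thesis
    by (simp add: gain_kernel_def)
qed (auto simp: gain_kernel_def)

lemma integrable_gain_kernel:
  assumes [measurable]: "u \<in> borel_measurable borel" and u: "\<And>x. 0 \<le> x \<Longrightarrow> \<bar>u x\<bar> \<le> M"
  shows "integrable N (gain_kernel u x)"
  by (rule N.integrable_const_bound[of _ "\<bar>M\<bar>"])
     (use gain_kernel_bound[of u M x] u in auto)

text \<open>The substitution \<open>x = b / d + v / r\<close> turns the event \<open>b < d x\<close>
  into \<open>0 < v\<close> and the level after the gain into \<open>v + y\<close>. The dilation by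
  \<open>1 / r\<close> produces the argument \<open>s / r\<close>, which is \<open>zeta\<close> at
  \<open>s\<close>.\<close>

lemma laplace_transform_gain_kernel:
  assumes [measurable]: "u \<in> borel_measurable borel" and b: "0 \<le> b" and y: "0 \<le> y"
  shows "laplace_transform (\<lambda>x. gain_kernel u x (b, y)) s
    = exp (- (s / of_real d) * of_real b) / of_real r * laplace_transform (\<lambda>v. u (v + y)) (s / of_real r)"
proof -
  have [measurable]: "(\<lambda>x. gain_kernel u (f x) (b, y)) \<in> borel_measurable borel" if [measurable]: "f \<in> borel_measurable borel" for f
    unfolding gain_kernel_def by measurable
  let ?f = "\<lambda>x. indicator {0..} x *\<^sub>R (exp (- s * of_real x) * complex_of_real (gain_kernel u x (b, y)))"
  have "laplace_transform (\<lambda>x. gain_kernel u x (b, y)) s = (\<integral>x. ?f x \<partial>lborel)"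
    by (simp add: laplace_transform_def set_lebesgue_integral_def)
  also have "\<dots> = \<bar>1 / r\<bar> *\<^sub>R (\<integral>v. ?f (b / d + 1 / r * v) \<partial>lborel)"
    using pos by (intro lborel_integral_real_affine) auto
  also have "(\<integral>v. ?f (b / d + 1 / r * v) \<partial>lborel)
      = (\<integral>v. exp (- (s / of_real d) * of_real b) *
          (indicator {0..} v *\<^sub>R (exp (- (s / of_real r) * of_real v) * complex_of_real (u (v + y)))) \<partial>lborel)"
  proof (rule integral_cong_AE)
    \<comment> \<open>At \<open>v = 0\<close> the strict inequality in the kernel and the closed
      half-line of the transform disagree.\<close>
    show "AE v in lborel. ?f (b / d + 1 / r * v) = exp (- (s / of_real d) * of_real b) *
          (indicator {0..} v *\<^sub>R (exp (- (s / of_real r) * of_real v) * complex_of_real (u (v + y))))"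
      using AE_lborel_singleton[of 0]
    proof eventually_elim
      case (elim v)
      have e: "d * (b / d + 1 / r * v) - b = v / g" "b < d * (b / d + 1 / r * v) \<longleftrightarrow> 0 < v"
        using pos by (simp_all add: r_def field_simps zero_less_mult_iff)
      have "exp (- s * of_real (b / d + 1 / r * v)) = exp (- (s / of_real d) * of_real b) * exp (- (s / of_real r) * of_real v)"
        by (simp add: algebra_simps flip: exp_add)
      moreover have "0 < v \<Longrightarrow> 0 \<le> b / d + 1 / r * v" using pos b by simp
      ultimately show ?case
        using elim pos b y e by (auto simp: gain_kernel_def indicator_def)
    qed
  qed measurable
  also have "\<bar>1 / r\<bar> *\<^sub>R \<dots> = exp (- (s / of_real d) * of_real b) / of_real r * laplace_transform (\<lambda>v. u (v + y)) (s / of_real r)"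
    using pos by (simp add: laplace_transform_def set_lebesgue_integral_def scaleR_conv_of_real)
  finally show ?thesis .
qed

end

section \<open>Partial fractions behind \<open>J\<close> and \<open>H\<close>\<close>

text \<open>\<open>A\<close>, \<open>B\<close>, \<open>P\<close>, \<open>Q\<close> stand for
  \<open>s + lam d\<close>, \<open>s + 2 lam d\<close>, \<open>\<mu> r - s\<close>,
  \<open>2 \<mu> r - s\<close>, and \<open>X\<close> for \<open>lam \<mu> d\<close>. The two
  relations for \<open>s\<close> give \<open>s^2 = (2 A - B) (Q - 2 P)\<close>, which splits the
  compact fractions of \<open>J\<close> and \<open>H\<close> into terms whose denominators pair one
  of \<open>A\<close>, \<open>B\<close> with one of \<open>P\<close>, \<open>Q\<close>.\<close>

lemma fgm_partial_fractions:
  fixes A B P Q X t s :: "'a::field"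
  assumes "A \<noteq> 0" "B \<noteq> 0" "P \<noteq> 0" "Q \<noteq> 0" and s: "s = 2 * A - B" "s = Q - 2 * P"
  shows "(1 + t) * (X / (A * P)) - t * (2 * X / (B * P)) + (t * (2 * 2 * X / (B * Q)) - t * (2 * X / (A * Q)))
      = X * (B * Q - t * s\<^sup>2) / (B * Q * A * P)"
    and "1 / A * (1 - X * ((s * (1 - t) + 2 * (B - A)) / (B * P) * p + 2 * t * s / (B * Q) * q))
      = 1 / A - ((1 + t) * (X / (A * P)) - t * (2 * X / (B * P))) * p
          - (t * (2 * 2 * X / (B * Q)) - t * (2 * X / (A * Q))) * q"
proof -
  have s2: "t * s\<^sup>2 = t * ((2 * A - B) * (Q - 2 * P))"
    using s by (simp add: power2_eq_square)
  have e: "X / (A * P) = X * (B * Q) / (B * Q * A * P)" "2 * X / (B * P) = 2 * X * (A * Q) / (B * Q * A * P)"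
    "2 * 2 * X / (B * Q) = 2 * 2 * X * (A * P) / (B * Q * A * P)" "2 * X / (A * Q) = 2 * X * (B * P) / (B * Q * A * P)"
    using assms(1-4) by simp_all
  show "(1 + t) * (X / (A * P)) - t * (2 * X / (B * P)) + (t * (2 * 2 * X / (B * Q)) - t * (2 * X / (A * Q)))
      = X * (B * Q - t * s\<^sup>2) / (B * Q * A * P)"
    unfolding e s2 times_divide_eq_right diff_divide_distrib[symmetric] add_divide_distrib[symmetric]
    by (rule arg_cong2[where f = "(/)"]) (algebra, rule refl)
  have n: "s * (1 - t) + 2 * (B - A) = (1 + t) * B - 2 * t * A"
    using s(1) by algebra
  have q: "2 * t * s = 2 * 2 * t * A - 2 * t * B"
    using s(1) by algebra
  have f: "((1 + t) * B - 2 * t * A) / (B * P) * X / A = (1 + t) * (X / (A * P)) - t * (2 * X / (B * P))"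
    using assms(1-4) by (simp add: field_simps)
  have h: "(2 * 2 * t * A - 2 * t * B) / (B * Q) * X / A = t * (2 * 2 * X / (B * Q)) - t * (2 * X / (A * Q))"
    using assms(1-4) by (simp add: field_simps)
  show "1 / A * (1 - X * ((s * (1 - t) + 2 * (B - A)) / (B * P) * p + 2 * t * s / (B * Q) * q))
      = 1 / A - ((1 + t) * (X / (A * P)) - t * (2 * X / (B * P))) * p
          - (t * (2 * 2 * X / (B * Q)) - t * (2 * X / (A * Q))) * q"
    unfolding n q f[symmetric] h[symmetric]
    by (simp add: diff_divide_distrib add_divide_distrib algebra_simps)
qed
context fgm_dual_risk
begin

text \<open>The multiplier that independent \<open>B ~ exp l\<close> and \<open>C ~ exp m\<close> would produce in the transform
  of the transition operator; the copula mixes four of these.\<close>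

definition mode_factor :: "real \<Rightarrow> real \<Rightarrow> complex \<Rightarrow> complex" where
  "mode_factor l m s = of_real (l * m * d) / ((s + of_real (l * d)) * (of_real (m * r) - s))"

text \<open>\<open>coef1\<close> collects the modes in which \<open>C\<close> has rate
  \<open>\<mu>\<close>, and \<open>coef2\<close> those with rate \<open>2 \<mu>\<close>; they
  therefore multiply the transform values at \<open>\<mu>\<close> and at
  \<open>2 \<mu>\<close>.\<close>

definition coef1 :: "complex \<Rightarrow> complex" where
  "coef1 s = (1 + of_real \<theta>) * mode_factor lam \<mu> s - of_real \<theta> * mode_factor (2 * lam) \<mu> s"

definition coef2 :: "complex \<Rightarrow> complex" where
  "coef2 s = of_real \<theta> * mode_factor (2 * lam) (2 * \<mu>) s - of_real \<theta> * mode_factor lam (2 * \<mu>) s"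

lemma measurable_laplace_shift [measurable]:
  assumes [measurable]: "u \<in> borel_measurable borel"
  shows "(\<lambda>y. laplace_transform (\<lambda>v. u (v + y)) z) \<in> borel_measurable borel"
  unfolding laplace_transform_def set_lebesgue_integral_def
  by (rule lborel.borel_measurable_lebesgue_integral) measurable

text \<open>By Fubini the transform in \<open>x\<close> can be taken first, for a fixed gain
  \<open>(b, y)\<close>. The result is a function of \<open>b\<close> times a function of
  \<open>y\<close>, so integration against \<open>N\<close> reduces to the four modes, each carrying
  a factor \<open>U (s / r) - U m\<close> with \<open>m\<close> the rate of
  \<open>C\<close>.\<close>

lemma laplace_gain_op:
  fixes u :: "real \<Rightarrow> real"
  assumes [measurable]: "u \<in> borel_measurable borel" and u: "\<And>x. 0 \<le> x \<Longrightarrow> \<bar>u x\<bar> \<le> M"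
    and s: "0 < Re s" "s \<noteq> of_real (\<mu> * r)" "s \<noteq> of_real (2 * \<mu> * r)"
  defines "U \<equiv> laplace_transform u"
  shows "laplace_transform (gain_op u) s =
    coef1 s * (U (s / of_real r) - U (of_real \<mu>)) + coef2 s * (U (s / of_real r) - U (of_real (2 * \<mu>)))"
proof -
  interpret LN: pair_sigma_finite lborel N ..
  define z where "z = s / of_real r"
  have Rez: "0 < Re z" using s pos by (simp add: z_def)
  \<comment> \<open>The two excluded values of \<open>s\<close> are exactly those at which
    \<open>z\<close> meets a rate of \<open>C\<close>.\<close>
  have zne: "z \<noteq> of_real \<mu>" "z \<noteq> of_real (2 * \<mu>)"
    using s pos by (auto simp: z_def field_simps simp flip: of_real_mult)
  define F where "F x p = indicator {0..} x *\<^sub>R (exp (- s * of_real x) * complex_of_real (gain_kernel u x p))" for x p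
  have [measurable]: "case_prod F \<in> borel_measurable (lborel \<Otimes>\<^sub>M N)"
  proof -
    have "(\<lambda>p. F (fst p) (snd p)) \<in> borel_measurable (borel \<Otimes>\<^sub>M N)"
      unfolding F_def using measurable_gain_kernel(1)[of u] by measurable
    moreover have sets: "sets (lborel \<Otimes>\<^sub>M N :: (real \<times> real \<times> real) measure) = sets (borel \<Otimes>\<^sub>M N)"
      by (rule sets_pair_measure_cong) simp_all
    moreover have "case_prod F = (\<lambda>p. F (fst p) (snd p))" by auto
    ultimately show ?thesis
      by (simp only: measurable_cong_sets[OF sets refl])
  qed
  have gk: "integrable N (gain_kernel u x)" for x
    by (rule integrable_gain_kernel) (use u in auto)
  have intF: "integrable N (F x)" for x
    unfolding F_def using gk[of x] by (intro integrable_scaleR_right integrable_mult_right integrable_of_real)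
  have nF: "norm (F x p) \<le> \<bar>M\<bar> * (indicator {0..} x * exp (- Re s * x))" for x p
    using gain_kernel_bound[of u M x p] u
    by (auto simp: F_def norm_mult indicator_def mult.commute intro!: mult_right_mono)
  have int: "integrable (lborel \<Otimes>\<^sub>M N) (case_prod F)"
  proof (rule LN.Fubini_integrable)
    show "integrable lborel (\<lambda>x. \<integral>p. norm (case_prod F (x, p)) \<partial>N)"
    proof (rule Bochner_Integration.integrable_bound)
      show "integrable lborel (\<lambda>x. \<bar>M\<bar> * (indicator {0..} x * exp (- Re s * x)))"
        by (rule integrable_mult_right[OF integrable_exp_minus_Ici(1)[OF s(1)]])
      show "AE x in lborel. norm (\<integral>p. norm (case_prod F (x, p)) \<partial>N) \<le> norm (\<bar>M\<bar> * (indicator {0..} x * exp (- Re s * x)))"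
      proof (rule AE_I2)
        fix x
        have "(\<integral>p. norm (F x p) \<partial>N) \<le> (\<integral>p. \<bar>M\<bar> * (indicator {0..} x * exp (- Re s * x)) \<partial>N)"
          using intF nF by (intro integral_mono integrable_norm) auto
        also have "\<dots> = \<bar>M\<bar> * (indicator {0..} x * exp (- Re s * x))"
          using N.prob_space by simp
        also have "\<dots> \<le> \<bar>\<bar>M\<bar> * (indicator {0..} x * exp (- Re s * x))\<bar>" by (rule abs_ge_self)
        finally show "norm (\<integral>p. norm (case_prod F (x, p)) \<partial>N) \<le> norm (\<bar>M\<bar> * (indicator {0..} x * exp (- Re s * x)))"
          by simp
      qed
    qed measurable
  qed (use intF in \<open>auto simp: case_prod_beta'\<close>)
  define \<phi> where "\<phi> b = (1 / of_real r) * exp (- (s / of_real d) * of_real b)" for b :: real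
  define \<psi> where "\<psi> y = laplace_transform (\<lambda>v. u (v + y)) z" for y
  have meas [measurable]: "\<phi> \<in> borel_measurable borel" "\<psi> \<in> borel_measurable borel"
    unfolding \<phi>_def[abs_def] \<psi>_def[abs_def] by measurable
  have \<phi>_int: "integrable lborel (\<lambda>x. exponential_density l x *\<^sub>R \<phi> x)" if "0 < l" for l
  proof (rule integrable_exponential_density_bounded[OF that])
    show "norm (\<phi> x) \<le> 1 / r" if "0 \<le> x" for x
      using that s pos by (simp add: \<phi>_def norm_mult norm_divide field_simps)
  qed measurable
  have \<psi>_int: "integrable lborel (\<lambda>x. exponential_density l x *\<^sub>R \<psi> x)" if "0 < l" for l
  proof (rule integrable_exponential_density_bounded[OF that])
    show "norm (\<psi> x) \<le> M / Re z" if "0 \<le> x" for x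
      unfolding \<psi>_def by (rule laplace_transform_bound) (use that u Rez in auto)
  qed measurable
  have A: "(\<integral>x. exponential_density l x *\<^sub>R \<phi> x \<partial>lborel) = of_real (l * d) / ((s + of_real (l * d)) * of_real r)" if "0 < l" for l
  proof -
    have "(\<integral>x. exponential_density l x *\<^sub>R \<phi> x \<partial>lborel)
        = (\<integral>x. (1 / of_real r) * (exponential_density l x *\<^sub>R exp (- (s / of_real d) * of_real x)) \<partial>lborel)"
      by (simp add: \<phi>_def)
    also have "\<dots> = 1 / of_real r * (of_real l / (of_real l + s / of_real d))"
      using exponential_density_laplace[OF that, of "s / of_real d"] s pos by (simp only: integral_mult_right_zero) simp
    also have "\<dots> = of_real (l * d) / ((s + of_real (l * d)) * of_real r)"
    proof -
      have "of_real l + s / of_real d = (s + of_real (l * d)) / of_real d"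
        using pos by (simp add: field_simps)
      then show ?thesis using pos by simp
    qed
    finally show ?thesis .
  qed
  have B: "(\<integral>x. exponential_density m x *\<^sub>R \<psi> x \<partial>lborel) = of_real (m * r) / (of_real (m * r) - s) * (U z - U (of_real m))"
    if "0 < m" "z \<noteq> of_real m" for m
  proof -
    have "(\<integral>x. exponential_density m x *\<^sub>R \<psi> x \<partial>lborel) = of_real m / (of_real m - z) * (U z - U (of_real m))"
      unfolding \<psi>_def U_def by (rule exponential_density_laplace_shift) (use that u Rez in auto)
    also have "of_real m - z = (of_real (m * r) - s) / of_real r"
      using pos by (simp add: z_def field_simps)
    finally show ?thesis using pos by simp
  qed
  have AB: "(\<integral>x. exponential_density l x *\<^sub>R \<phi> x \<partial>lborel) * (\<integral>x. exponential_density m x *\<^sub>R \<psi> x \<partial>lborel)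
      = mode_factor l m s * (U z - U (of_real m))" if "0 < l" "0 < m" "z \<noteq> of_real m" for l m
    unfolding A[OF that(1)] B[OF that(2,3)] mode_factor_def using pos by simp
  have "laplace_transform (gain_op u) s = (\<integral>x. \<integral>p. F x p \<partial>N \<partial>lborel)"
    unfolding laplace_transform_def set_lebesgue_integral_def F_def gain_op_def
    by (simp only: integral_scaleR_right integral_mult_right_zero integral_complex_of_real)
  also have "\<dots> = (\<integral>p. \<integral>x. F x p \<partial>lborel \<partial>N)"
    using LN.Fubini_integral[OF int] by simp
  also have "\<dots> = (\<integral>p. \<phi> (fst p) * \<psi> (snd p) \<partial>N)"
  proof (rule integral_cong_AE)
    show "(\<lambda>p. \<integral>x. F x p \<partial>lborel) \<in> borel_measurable N"
      using LN.integrable_snd[OF int] by (rule borel_measurable_integrable)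
    have "(\<lambda>p. \<phi> (fst p) * \<psi> (snd p)) \<in> borel_measurable (borel \<Otimes>\<^sub>M borel)" by measurable
    then show "(\<lambda>p. \<phi> (fst p) * \<psi> (snd p)) \<in> borel_measurable N"
      by (simp only: borel_prod measurable_cong_sets[OF sets_N refl])
    show "AE p in N. (\<integral>x. F x p \<partial>lborel) = \<phi> (fst p) * \<psi> (snd p)"
      using AE_N_nonneg
    proof eventually_elim
      case (elim p)
      then show ?case
        using laplace_transform_gain_kernel[of u "fst p" "snd p" s]
        by (simp add: laplace_transform_def set_lebesgue_integral_def F_def \<phi>_def \<psi>_def z_def)
    qed
  qed
  also have "\<dots> = coef1 s * (U z - U (of_real \<mu>)) + coef2 s * (U z - U (of_real (2 * \<mu>)))"
  proof -
    have "0 < 2 * lam" "0 < 2 * \<mu>" using lam mu by auto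
    note AB' = AB[OF lam mu zne(1)] AB[OF \<open>0 < 2 * lam\<close> mu zne(1)]
      AB[OF lam \<open>0 < 2 * \<mu>\<close> zne(2)] AB[OF \<open>0 < 2 * lam\<close> \<open>0 < 2 * \<mu>\<close> zne(2)]
    show ?thesis
      by (subst integral_N_product(2), rule meas, rule meas, erule \<phi>_int, erule \<psi>_int,
          unfold AB' coef1_def coef2_def) (simp add: algebra_simps)
  qed
  finally show ?thesis unfolding z_def .
qed

lemma denominators_nonzero:
  assumes "0 < Re s" "0 < l"
  shows "s + of_real (l * d) \<noteq> 0"
proof -
  have "0 < Re (s + of_real (l * d))"
    using assms pos by (simp add: add_pos_pos)
  then show ?thesis by (metis less_irrefl zero_complex.sel(1))
qed

lemma J_H_eq_coef:
  assumes "0 < Re s" "s \<noteq> of_real (\<mu> * r)" "s \<noteq> of_real (2 * \<mu> * r)"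
  shows "J lam \<mu> a c \<theta> s = coef1 s + coef2 s"
    and "H lam \<mu> a c \<theta> p q s = 1 / (s + of_real (lam * d)) - coef1 s * p - coef2 s * q"
proof -
  define t X where "t = complex_of_real \<theta>" and "X = complex_of_real (lam * \<mu> * d)"
  define A B P Q where "A = s + of_real (lam * d)" and "B = s + of_real (2 * lam * d)"
    and "P = of_real (\<mu> * r) - s" and "Q = of_real (2 * \<mu> * r) - s"
  have n: "A \<noteq> 0" "B \<noteq> 0" "P \<noteq> 0" "Q \<noteq> 0"
    using denominators_nonzero[OF assms(1), of lam] denominators_nonzero[OF assms(1), of "2 * lam"] lam assms(2,3)
    by (auto simp: A_def B_def P_def Q_def)
  have s: "s = 2 * A - B" "s = Q - 2 * P"
    by (simp_all add: A_def B_def P_def Q_def)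
  have k: "coef1 s = (1 + t) * (X / (A * P)) - t * (2 * X / (B * P))"
      "coef2 s = t * (2 * 2 * X / (B * Q)) - t * (2 * X / (A * Q))"
    by (simp_all add: coef1_def coef2_def mode_factor_def t_def X_def A_def B_def P_def Q_def mult_ac)
  have "J lam \<mu> a c \<theta> s = X * (B * Q - t * s\<^sup>2) / (B * Q * A * P)"
    by (simp add: J_def Let_def t_def X_def A_def B_def P_def Q_def r_def d_def g_def mult.assoc)
  then show "J lam \<mu> a c \<theta> s = coef1 s + coef2 s"
    unfolding k fgm_partial_fractions(1)[OF n s] .
  have "H lam \<mu> a c \<theta> p q s = 1 / A * (1 - X * ((s * (1 - t) + 2 * (B - A)) / (B * P) * p + 2 * t * s / (B * Q) * q))"
    by (simp add: H_def Let_def t_def X_def A_def B_def P_def Q_def r_def d_def g_def mult.assoc)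
  then show "H lam \<mu> a c \<theta> p q s = 1 / (s + of_real (lam * d)) - coef1 s * p - coef2 s * q"
    unfolding k fgm_partial_fractions(2)[OF n s] A_def[symmetric] .
qed

lemma zeta_funpow: "(zeta a c ^^ k) s = s / of_real (r ^ k)"
  by (induction k) (simp_all add: zeta_def r_def d_def g_def mult_ac)


section \<open>Iterating the functional equation\<close>

text \<open>On the right half-plane, away from the poles \<open>\<mu> r\<close> and
  \<open>2 \<mu> r\<close>, this is \<open>J\<close>; the form as a sum is the one whose limits
  along an orbit are easy to take.\<close>

definition J_sum :: "complex \<Rightarrow> complex" where "J_sum s = coef1 s + coef2 s"

definition J_prod :: "nat \<Rightarrow> complex \<Rightarrow> complex" where
  "J_prod n s = (\<Prod>j<n. J_sum (s / of_real (r ^ j)))"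

definition regular :: "complex \<Rightarrow> bool" where
  "regular s \<longleftrightarrow> 0 < Re s \<and>
     (\<forall>j. s / of_real (r ^ j) \<noteq> of_real (\<mu> * r) \<and> s / of_real (r ^ j) \<noteq> of_real (2 * \<mu> * r))"

text \<open>The last clause selects, for \<open>r > 1\<close>, the solutions whose series has no remainder: the survival
  probability satisfies the homogeneous equation but tends to \<open>1\<close>.\<close>

definition solves :: "(real \<Rightarrow> real) \<Rightarrow> (real \<Rightarrow> real) \<Rightarrow> bool" where
  "solves f u \<longleftrightarrow> f \<in> borel_measurable borel \<and> u \<in> borel_measurable borel
     \<and> (\<exists>M. \<forall>x\<ge>0. \<bar>f x\<bar> \<le> M \<and> \<bar>u x\<bar> \<le> M)
     \<and> (\<forall>x\<ge>0. u x = f x + gain_op u x)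
     \<and> (1 < r \<longrightarrow> (u \<longlongrightarrow> 0) at_top)"

lemma solvesE:
  assumes "solves f u"
  obtains M where "f \<in> borel_measurable borel" "u \<in> borel_measurable borel"
    "\<And>x. 0 \<le> x \<Longrightarrow> \<bar>f x\<bar> \<le> M" "\<And>x. 0 \<le> x \<Longrightarrow> \<bar>u x\<bar> \<le> M"
    "\<And>x. 0 \<le> x \<Longrightarrow> u x = f x + gain_op u x" "1 < r \<Longrightarrow> (u \<longlongrightarrow> 0) at_top"
proof -
  from assms obtain M where "\<forall>x\<ge>0. \<bar>f x\<bar> \<le> M \<and> \<bar>u x\<bar> \<le> M"
    unfolding solves_def by blast
  with assms show ?thesis
    unfolding solves_def by (intro that[of M]) blast+
qed

lemma solvesI:
  assumes "f \<in> borel_measurable borel" "u \<in> borel_measurable borel"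
    "\<And>x. 0 \<le> x \<Longrightarrow> \<bar>f x\<bar> \<le> M" "\<And>x. 0 \<le> x \<Longrightarrow> \<bar>u x\<bar> \<le> M"
    "\<And>x. 0 \<le> x \<Longrightarrow> u x = f x + gain_op u x" "1 < r \<Longrightarrow> (u \<longlongrightarrow> 0) at_top"
  shows "solves f u"
  unfolding solves_def using assms by blast

text \<open>The transform of \<open>u = f + gain_op u\<close>. The first group of terms is
  \<open>H\<close> when \<open>f\<close> is the no-gain probability and the unknowns are the
  transform values of \<open>u\<close>; a general \<open>f\<close> is kept for the uniqueness
  argument.\<close>

lemma functional_equation:
  assumes sol: "solves f u" and s: "0 < Re s" "s \<noteq> of_real (\<mu> * r)" "s \<noteq> of_real (2 * \<mu> * r)"
  shows "laplace_transform u s =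
    (laplace_transform f s - coef1 s * laplace_transform u (of_real \<mu>) - coef2 s * laplace_transform u (of_real (2 * \<mu>)))
    + J_sum s * laplace_transform u (s / of_real r)"
proof -
  from sol obtain M where [measurable]: "f \<in> borel_measurable borel" "u \<in> borel_measurable borel"
    and M: "\<And>x. 0 \<le> x \<Longrightarrow> \<bar>f x\<bar> \<le> M" "\<And>x. 0 \<le> x \<Longrightarrow> \<bar>u x\<bar> \<le> M"
    and eq: "\<And>x. 0 \<le> x \<Longrightarrow> u x = f x + gain_op u x"
    by (rule solvesE) blast
  have K: "\<bar>gain_op u x\<bar> \<le> 2 * M" if "0 \<le> x" for x
    using eq[OF that] M[OF that] by linarith
  have "laplace_transform u s = (\<integral>x. indicator {0..} x *\<^sub>R (exp (- s * of_real x) * complex_of_real (f x))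
      + indicator {0..} x *\<^sub>R (exp (- s * of_real x) * complex_of_real (gain_op u x)) \<partial>lborel)"
    unfolding laplace_transform_def set_lebesgue_integral_def
  proof (rule Bochner_Integration.integral_cong)
    fix x
    show "indicator {0..} x *\<^sub>R (exp (- s * of_real x) * complex_of_real (u x))
      = indicator {0..} x *\<^sub>R (exp (- s * of_real x) * complex_of_real (f x))
      + indicator {0..} x *\<^sub>R (exp (- s * of_real x) * complex_of_real (gain_op u x))"
      by (cases "0 \<le> x") (simp_all only: eq of_real_add distrib_left scaleR_right_distrib, simp)
  qed simp
  also have "\<dots> = laplace_transform f s + laplace_transform (gain_op u) s"
    unfolding laplace_transform_def set_lebesgue_integral_def
    by (rule Bochner_Integration.integral_add; rule laplace_transform_integrable) (use M K s in auto)
  also have "laplace_transform (gain_op u) s =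
     coef1 s * (laplace_transform u (s / of_real r) - laplace_transform u (of_real \<mu>))
     + coef2 s * (laplace_transform u (s / of_real r) - laplace_transform u (of_real (2 * \<mu>)))"
    by (rule laplace_gain_op) (use M s in auto)
  finally show ?thesis by (simp add: J_sum_def algebra_simps)
qed

text \<open>Write \<open>z_k = s / r^k\<close> and \<open>U\<close> for the transform of
  \<open>u\<close>. By the functional equation at \<open>z_k\<close> the bracket of index
  \<open>k\<close> is \<open>U z_k - J_sum z_k * U z_(k+1)\<close>, so the weighted sum
  telescopes.\<close>

lemma partial_sums:
  assumes sol: "solves f u" and s: "regular s"
  shows "(\<Sum>k<n. J_prod k s * (laplace_transform f (s / of_real (r ^ k))
       - coef1 (s / of_real (r ^ k)) * laplace_transform u (of_real \<mu>)
       - coef2 (s / of_real (r ^ k)) * laplace_transform u (of_real (2 * \<mu>))))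
    = laplace_transform u s - J_prod n s * laplace_transform u (s / of_real (r ^ n))"
proof (induction n)
  case (Suc n)
  have "0 < Re (s / of_real (r ^ n))"
    using s pos by (simp add: regular_def Re_divide_of_real)
  from functional_equation[OF sol this] s
  have E: "laplace_transform u (s / of_real (r ^ n)) = (laplace_transform f (s / of_real (r ^ n))
       - coef1 (s / of_real (r ^ n)) * laplace_transform u (of_real \<mu>)
       - coef2 (s / of_real (r ^ n)) * laplace_transform u (of_real (2 * \<mu>)))
       + J_sum (s / of_real (r ^ n)) * laplace_transform u (s / of_real (r ^ Suc n))"
    by (simp add: regular_def mult.commute)
  have PPS: "J_prod (Suc n) s = J_prod n s * J_sum (s / of_real (r ^ n))"
    by (simp add: J_prod_def)
  show ?case
    unfolding sum.lessThan_Suc Suc.IH PPS by (subst E) (simp only: algebra_simps)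
qed (simp add: J_prod_def)

section \<open>Convergence along the orbit \<open>s / r^k\<close>\<close>

lemma iterate_tendsto_0:
  assumes "1 < r"
  shows "(\<lambda>n. s / of_real (r ^ n) :: complex) \<longlonglongrightarrow> 0"
proof -
  have "(\<lambda>n. s * of_real ((1 / r) ^ n) :: complex) \<longlonglongrightarrow> s * of_real 0"
    using assms by (intro tendsto_intros LIMSEQ_realpow_zero) auto
  then show ?thesis by (simp add: power_divide)
qed

lemma iterate_at_infinity:
  assumes "r < 1" "s \<noteq> 0"
  shows "filterlim (\<lambda>n. s / of_real (r ^ n) :: complex) at_infinity sequentially"
proof -
  have "(\<lambda>n. of_real (r ^ n) / s :: complex) \<longlonglongrightarrow> of_real 0 / s"
    using assms pos by (intro tendsto_intros LIMSEQ_realpow_zero) auto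
  then have "filterlim (\<lambda>n. of_real (r ^ n) / s :: complex) (at 0) sequentially"
    using assms pos by (intro filterlim_atI) auto
  from filterlim_compose[OF filterlim_inverse_at_infinity this] show ?thesis by simp
qed

text \<open>At 0 the rates \<open>l\<close> and \<open>m\<close> cancel and the mode factor equals
  \<open>1 / r\<close>; at infinity a constant stands over a quadratic.\<close>

lemma mode_factor_tendsto:
  assumes l: "0 < l" and m: "0 < m" and s: "s \<noteq> 0"
  shows "1 < r \<Longrightarrow> (\<lambda>n. mode_factor l m (s / of_real (r ^ n))) \<longlonglongrightarrow> of_real (1 / r)"
    and "r < 1 \<Longrightarrow> (\<lambda>n. mode_factor l m (s / of_real (r ^ n))) \<longlonglongrightarrow> 0"
proof -
  assume r: "1 < r"
  have "(\<lambda>n. mode_factor l m (s / of_real (r ^ n)))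
      \<longlonglongrightarrow> of_real (l * m * d) / ((0 + of_real (l * d)) * (of_real (m * r) - 0))"
    unfolding mode_factor_def using pos l m
    by (intro tendsto_intros iterate_tendsto_0[OF r]) auto
  also have "of_real (l * m * d) / ((0 + of_real (l * d)) * (of_real (m * r) - 0)) = (of_real (1 / r) :: complex)"
    using pos l m by simp
  finally show "(\<lambda>n. mode_factor l m (s / of_real (r ^ n))) \<longlonglongrightarrow> of_real (1 / r)" .
next
  assume r: "r < 1"
  have inf: "filterlim (\<lambda>n. s / of_real (r ^ n)) at_infinity sequentially"
    by (rule iterate_at_infinity[OF r s])
  have "filterlim (\<lambda>n. (s / of_real (r ^ n) + of_real (l * d)) * (of_real (m * r) - s / of_real (r ^ n))) at_infinity sequentially"
  proof (rule filterlim_at_infinity_times)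
    show "filterlim (\<lambda>n. s / of_real (r ^ n) + of_real (l * d)) at_infinity sequentially"
      using tendsto_add_filterlim_at_infinity[OF tendsto_const inf, of "of_real (l * d)"] by (simp add: add.commute)
    have "filterlim (\<lambda>n. - (s / of_real (r ^ n))) at_infinity sequentially"
      using inf by (simp add: filterlim_at_infinity_conv_norm_at_top)
    from tendsto_add_filterlim_at_infinity[OF tendsto_const this, of "of_real (m * r)"]
    show "filterlim (\<lambda>n. of_real (m * r) - s / of_real (r ^ n)) at_infinity sequentially" by simp
  qed
  from tendsto_divide_0[OF tendsto_const this]
  show "(\<lambda>n. mode_factor l m (s / of_real (r ^ n))) \<longlonglongrightarrow> 0"
    unfolding mode_factor_def .
qed

text \<open>For \<open>1 < r\<close> all mode factors share the limit \<open>1 / r\<close>, and the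
  weights sum to 1 in \<open>coef1\<close> and to 0 in \<open>coef2\<close>.\<close>

lemma coef_tendsto:
  assumes "s \<noteq> 0"
  shows "1 < r \<Longrightarrow> (\<lambda>n. coef1 (s / of_real (r ^ n))) \<longlonglongrightarrow> of_real (1 / r)"
    and "1 < r \<Longrightarrow> (\<lambda>n. coef2 (s / of_real (r ^ n))) \<longlonglongrightarrow> 0"
    and "r < 1 \<Longrightarrow> (\<lambda>n. coef1 (s / of_real (r ^ n))) \<longlonglongrightarrow> 0"
    and "r < 1 \<Longrightarrow> (\<lambda>n. coef2 (s / of_real (r ^ n))) \<longlonglongrightarrow> 0"
proof -
  have p: "0 < 2 * lam" "0 < 2 * \<mu>" using lam mu by auto
  note m = mode_factor_tendsto[OF lam mu assms] mode_factor_tendsto[OF p(1) mu assms]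
    mode_factor_tendsto[OF lam p(2) assms] mode_factor_tendsto[OF p assms]
  show "(\<lambda>n. coef1 (s / of_real (r ^ n))) \<longlonglongrightarrow> of_real (1 / r)" if "1 < r"
    unfolding coef1_def using m(1,3)[OF that]
    by (auto intro!: tendsto_eq_intros simp: algebra_simps)
  show "(\<lambda>n. coef2 (s / of_real (r ^ n))) \<longlonglongrightarrow> 0" if "1 < r"
    unfolding coef2_def using m(5,7)[OF that]
    by (auto intro!: tendsto_eq_intros)
  show "(\<lambda>n. coef1 (s / of_real (r ^ n))) \<longlonglongrightarrow> 0" if "r < 1"
    unfolding coef1_def using m(2,4)[OF that]
    by (auto intro!: tendsto_eq_intros)
  show "(\<lambda>n. coef2 (s / of_real (r ^ n))) \<longlonglongrightarrow> 0" if "r < 1"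
    unfolding coef2_def using m(6,8)[OF that]
    by (auto intro!: tendsto_eq_intros)
qed

text \<open>Ratio test: the factors along the orbit tend to \<open>1 / r\<close> if
  \<open>1 < r\<close> and to 0 if \<open>r < 1\<close>. For \<open>r = 1\<close> the orbit is
  constant, and the hypothesis on \<open>J_sum s\<close> makes the series geometric.\<close>

lemma summable_J_prod:
  assumes s: "s \<noteq> 0" and conv: "r = 1 \<Longrightarrow> norm (J_sum s) < 1"
  shows "summable (\<lambda>n. norm (J_prod n s))"
proof -
  have "\<exists>q<1. \<forall>\<^sub>F n in sequentially. norm (J_sum (s / of_real (r ^ n))) \<le> q"
  proof -
    have *: ?thesis if L: "(\<lambda>n. J_sum (s / of_real (r ^ n))) \<longlonglongrightarrow> L" "norm L < 1" for L
    proof -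
      obtain q where "norm L < q" "q < 1" using L(2) dense by blast
      then show ?thesis
        using order_tendstoD(2)[OF tendsto_norm[OF L(1)], of q] by (auto elim!: eventually_mono intro!: exI[of _ q])
    qed
    consider "1 < r" | "r < 1" | "r = 1" by linarith
    then show ?thesis
    proof cases
      case 1
      then show ?thesis
        using * tendsto_add[OF coef_tendsto(1,2)[OF s 1 ]] by (auto simp: J_sum_def norm_divide)
    next
      case 2
      then show ?thesis
        using * tendsto_add[OF coef_tendsto(3,4)[OF s 2]] by (auto simp: J_sum_def)
    next
      case 3
      then show ?thesis using conv by (auto intro!: exI[of _ "norm (J_sum s)"])
    qed
  qed
  then obtain q K where q: "q < 1" and K: "\<And>n. n \<ge> K \<Longrightarrow> norm (J_sum (s / of_real (r ^ n))) \<le> q"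
    by (auto simp: eventually_sequentially)
  show ?thesis
  proof (rule summable_ratio_test[OF q])
    fix n assume "K \<le> n"
    then show "norm (norm (J_prod (Suc n) s)) \<le> q * norm (norm (J_prod n s))"
      using K[of n] by (simp add: J_prod_def norm_mult mult.commute mult_right_mono)
  qed
qed

lemma mode_factor_minus_one:
  assumes "z + of_real (l * d) \<noteq> 0" "of_real (m * r) - z \<noteq> 0"
  shows "of_real r * mode_factor l m z - 1
     = z * ((z + of_real (l * d) - of_real (m * r)) / ((z + of_real (l * d)) * (of_real (m * r) - z)))"
  using assms unfolding mode_factor_def
  by (simp add: divide_simps) (simp add: algebra_simps)

text \<open>The deviation from 1 is \<open>z\<close> times a quotient that stays bounded as
  \<open>z\<close> tends to 0, so along the orbit it is dominated by a geometric series of ratio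
  \<open>1 / r\<close>.\<close>

lemma summable_mode_factor_minus_one:
  assumes r: "1 < r" and l: "0 < l" and m: "0 < m" and s: "0 < Re s"
    and sm: "\<And>j. s / of_real (r ^ j) \<noteq> of_real (m * r)"
  shows "summable (\<lambda>n. norm (of_real r * mode_factor l m (s / of_real (r ^ n)) - 1))"
proof -
  define z where "z n = s / of_real (r ^ n)" for n
  define Q where "Q n = (z n + of_real (l * d) - of_real (m * r)) / ((z n + of_real (l * d)) * (of_real (m * r) - z n))" for n
  have "Q \<longlonglongrightarrow> (0 + of_real (l * d) - of_real (m * r)) / ((0 + of_real (l * d)) * (of_real (m * r) - 0))"
    unfolding Q_def[abs_def] z_def using pos l m by (intro tendsto_intros iterate_tendsto_0[OF r]) auto
  then have "Bseq Q" by (rule convergent_imp_Bseq[OF convergentI])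
  then obtain C where C: "\<And>n. norm (Q n) \<le> C" by (auto simp: Bseq_def)
  have eq: "of_real r * mode_factor l m (z n) - 1 = z n * Q n" for n
    unfolding Q_def
  proof (rule mode_factor_minus_one)
    have "0 < Re (z n)" using s pos by (simp add: z_def Re_divide_of_real)
    then show "z n + of_real (l * d) \<noteq> 0" using l by (rule denominators_nonzero)
    show "of_real (m * r) - z n \<noteq> 0" using sm[of n] by (simp add: z_def)
  qed
  have "summable (\<lambda>n. norm s * C * (1 / r) ^ n)"
    using r by (intro summable_mult summable_geometric) auto
  then show ?thesis
  proof (rule summable_comparison_test'[where N = 0])
    fix n
    have "norm (z n) * norm (Q n) \<le> norm (z n) * C"
      using C by (intro mult_left_mono) auto
    then show "norm (norm (of_real r * mode_factor l m (s / of_real (r ^ n)) - 1)) \<le> norm s * C * (1 / r) ^ n"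
      using eq[of n] pos by (simp add: z_def norm_mult norm_divide norm_power power_divide)
  qed
qed

text \<open>Giving one \<open>r\<close> to each factor leaves factors that deviate from 1 by a
  summable amount, so the partial products converge.\<close>

lemma Bseq_scaled_J_prod:
  assumes r: "1 < r" and s: "regular s"
  shows "Bseq (\<lambda>n. of_real (r ^ n) * J_prod n s)"
proof -
  define v where "v n = of_real r * J_sum (s / of_real (r ^ n))" for n
  define e where "e l m n = of_real r * mode_factor l m (s / of_real (r ^ n)) - 1" for l m n
  have sm: "summable (\<lambda>n. norm (e l m n))" if "l \<in> {lam, 2 * lam}" "m \<in> {\<mu>, 2 * \<mu>}" for l m
    unfolding e_def using that lam mu s r
    by (intro summable_mode_factor_minus_one) (auto simp: regular_def)
  \<comment> \<open>The four weights sum to 1, so the constants cancel.\<close>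
  have veq: "v n - 1 = (1 + of_real \<theta>) * e lam \<mu> n - of_real \<theta> * e (2 * lam) \<mu> n
      + of_real \<theta> * e (2 * lam) (2 * \<mu>) n - of_real \<theta> * e lam (2 * \<mu>) n" for n
    by (simp add: v_def e_def J_sum_def coef1_def coef2_def algebra_simps)
  have "summable (\<lambda>n. norm (v n - 1))"
  proof (rule summable_comparison_test'[where N = 0])
    show "summable (\<lambda>n. 2 * norm (e lam \<mu> n) + norm (e (2 * lam) \<mu> n) + norm (e (2 * lam) (2 * \<mu>) n) + norm (e lam (2 * \<mu>) n))"
      by (intro summable_add summable_mult sm) auto
    fix n
    have t: "norm (1 + complex_of_real \<theta>) \<le> 2" "norm (complex_of_real \<theta>) \<le> 1"
      using theta norm_of_real[of "1 + \<theta>", where 'a = complex] by simp_all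
    have "norm (v n - 1) \<le> norm ((1 + of_real \<theta>) * e lam \<mu> n) + norm (of_real \<theta> * e (2 * lam) \<mu> n)
      + norm (of_real \<theta> * e (2 * lam) (2 * \<mu>) n) + norm (of_real \<theta> * e lam (2 * \<mu>) n)"
      unfolding veq by norm
    also have "\<dots> \<le> 2 * norm (e lam \<mu> n) + 1 * norm (e (2 * lam) \<mu> n) + 1 * norm (e (2 * lam) (2 * \<mu>) n) + 1 * norm (e lam (2 * \<mu>) n)"
      unfolding norm_mult by (intro add_mono mult_right_mono t norm_ge_zero)
    finally show "norm (norm (v n - 1)) \<le> 2 * norm (e lam \<mu> n) + norm (e (2 * lam) \<mu> n) + norm (e (2 * lam) (2 * \<mu>) n) + norm (e lam (2 * \<mu>) n)"
      by simp
  qed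
  then have "convergent_prod v"
    by (intro abs_convergent_prod_imp_convergent_prod) (simp add: abs_convergent_prod_conv_summable)
  then have "convergent (\<lambda>n. \<Prod>i\<le>n. v i)"
    by (rule convergent_prod_imp_convergent)
  then have "convergent (\<lambda>n. \<Prod>i<Suc n. v i)"
    by (simp only: lessThan_Suc_atMost)
  then have "convergent (\<lambda>n. \<Prod>i<n. v i)"
    by (subst (asm) convergent_Suc_iff)
  then have "Bseq (\<lambda>n. \<Prod>i<n. v i)" by (rule convergent_imp_Bseq)
  moreover have "(\<Prod>i<n. v i) = of_real (r ^ n) * J_prod n s" for n
    by (simp add: v_def J_prod_def prod.distrib)
  ultimately show ?thesis by simp
qed

text \<open>After the substitution \<open>x = r^n v\<close> the integrand carries
  \<open>u (r^n v)\<close>, which tends to 0 for every \<open>v > 0\<close>; dominated convergence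
  applies.\<close>

lemma scaled_laplace_tendsto_0:
  assumes r: "1 < r" and s: "0 < Re s" and [measurable]: "u \<in> borel_measurable borel"
    and M: "\<And>x. 0 \<le> x \<Longrightarrow> \<bar>u x\<bar> \<le> M" and lim: "(u \<longlongrightarrow> 0) at_top"
  shows "(\<lambda>n. laplace_transform u (s / of_real (r ^ n)) / of_real (r ^ n)) \<longlonglongrightarrow> 0"
proof -
  define h where "h n v = indicator {0..} v *\<^sub>R (exp (- s * of_real v) * complex_of_real (u (r ^ n * v)))" for n and v :: real
  have eq: "laplace_transform u (s / of_real (r ^ n)) / of_real (r ^ n) = (\<integral>v. h n v \<partial>lborel)" for n
  proof -
    have rn: "0 < r ^ n" using r by simp
    have "laplace_transform u (s / of_real (r ^ n))
        = \<bar>r ^ n\<bar> *\<^sub>R (\<integral>v. indicator {0..} (0 + r ^ n * v) *\<^sub>R (exp (- (s / of_real (r ^ n)) * of_real (0 + r ^ n * v)) * complex_of_real (u (0 + r ^ n * v))) \<partial>lborel)"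
      unfolding laplace_transform_def set_lebesgue_integral_def
      by (rule lborel_integral_real_affine) (use r in auto)
    also have "(\<integral>v. indicator {0..} (0 + r ^ n * v) *\<^sub>R (exp (- (s / of_real (r ^ n)) * of_real (0 + r ^ n * v)) * complex_of_real (u (0 + r ^ n * v))) \<partial>lborel) = (\<integral>v. h n v \<partial>lborel)"
    proof (rule Bochner_Integration.integral_cong)
      fix v
      have "0 \<le> r ^ n * v \<longleftrightarrow> 0 \<le> v"
        using mult_le_cancel_left_pos[OF rn, of 0 v] by simp
      then show "indicator {0..} (0 + r ^ n * v) *\<^sub>R (exp (- (s / of_real (r ^ n)) * of_real (0 + r ^ n * v)) * complex_of_real (u (0 + r ^ n * v))) = h n v"
        using r by (simp add: h_def indicator_def)
    qed simp
    finally show ?thesis using r by (simp add: scaleR_conv_of_real)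
  qed
  have "(\<lambda>n. \<integral>v. h n v \<partial>lborel) \<longlonglongrightarrow> (\<integral>v. 0 \<partial>(lborel :: real measure))"
  proof (rule integral_dominated_convergence)
    show "integrable lborel (\<lambda>v. M * (indicator {0..} v * exp (- Re s * v)))"
      by (rule integrable_mult_right[OF integrable_exp_minus_Ici(1)[OF s]])
    show "AE v in lborel. (\<lambda>n. h n v) \<longlonglongrightarrow> 0"
      using AE_lborel_singleton[of 0]
    proof eventually_elim
      case (elim v)
      show ?case
      proof (cases "0 < v")
        case True
        have "filterlim (\<lambda>n. r ^ n * v) at_top sequentially"
          using filterlim_at_infinity_imp_norm_at_top[OF filterlim_realpow_sequentially_gt1[of r]] r
          by (intro filterlim_at_top_mult_tendsto_pos[OF tendsto_const True]) (simp add: norm_power)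
        from filterlim_compose[OF lim this]
        have "(\<lambda>n. u (r ^ n * v)) \<longlonglongrightarrow> 0" .
        then have "(\<lambda>n. indicator {0..} v *\<^sub>R (exp (- s * of_real v) * complex_of_real (u (r ^ n * v))))
            \<longlonglongrightarrow> indicator {0..} v *\<^sub>R (exp (- s * of_real v) * complex_of_real 0)"
          by (intro tendsto_intros)
        then show ?thesis by (simp add: h_def)
      qed (use elim in \<open>auto simp: h_def\<close>)
    qed
    show "AE v in lborel. norm (h n v) \<le> M * (indicator {0..} v * exp (- Re s * v))" for n
      using M r by (intro AE_I2) (auto simp: h_def norm_mult indicator_def mult.commute intro!: mult_right_mono)
  qed (auto simp: h_def)
  then show ?thesis unfolding eq by simp
qed

text \<open>For \<open>1 < r\<close> a power \<open>r^n\<close> is moved from one factor to the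
  other: the rescaled product stays bounded and the rescaled transform tends to 0. For
  \<open>r \<le> 1\<close> the product tends to 0 while the transform stays bounded, because the
  real parts along the orbit are at least \<open>Re s\<close>.\<close>

lemma remainder_tendsto_0:
  assumes sol: "solves f u" and s: "regular s" and conv: "r = 1 \<Longrightarrow> norm (J_sum s) < 1"
  shows "(\<lambda>n. J_prod n s * laplace_transform u (s / of_real (r ^ n))) \<longlonglongrightarrow> 0"
proof -
  from sol obtain M where [measurable]: "u \<in> borel_measurable borel"
    and M: "\<And>x. 0 \<le> x \<Longrightarrow> \<bar>u x\<bar> \<le> M" and lim: "1 < r \<Longrightarrow> (u \<longlongrightarrow> 0) at_top"
    by (rule solvesE) blast
  have s0: "0 < Re s" "s \<noteq> 0" using s by (auto simp: regular_def)
  show ?thesis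
  proof (cases "1 < r")
    case True
    obtain K where "\<forall>n. norm (of_real (r ^ n) * J_prod n s) \<le> K"
      using Bseq_scaled_J_prod[OF True s] by (auto simp only: Bseq_def)
    then have "(\<lambda>n. (of_real (r ^ n) * J_prod n s) * (laplace_transform u (s / of_real (r ^ n)) / of_real (r ^ n))) \<longlonglongrightarrow> 0"
      using scaled_laplace_tendsto_0[OF True s0(1) _ M lim[OF True]]
      by (intro lim_null_mult_left_bounded eventuallyI) auto
    then show ?thesis using pos by simp
  next
    case False
    have M0: "0 \<le> M" using M[of 0] by linarith
    have "Bseq (\<lambda>n. laplace_transform u (s / of_real (r ^ n)))"
    proof (rule BseqI')
      fix n
      have rn: "0 < r ^ n" "r ^ n \<le> 1" using False pos by (auto simp: power_le_one)
      have "norm (laplace_transform u (s / of_real (r ^ n))) \<le> M / Re (s / of_real (r ^ n))"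
        by (rule laplace_transform_bound) (use M s0 rn in \<open>auto simp: Re_divide_of_real\<close>)
      also have "\<dots> = r ^ n * (M / Re s)" using rn by (simp add: Re_divide_of_real)
      also have "\<dots> \<le> 1 * (M / Re s)" using rn M0 s0 by (intro mult_right_mono) auto
      finally show "norm (laplace_transform u (s / of_real (r ^ n))) \<le> M / Re s" by simp
    qed
    moreover have "(\<lambda>n. J_prod n s) \<longlonglongrightarrow> 0"
      using summable_LIMSEQ_zero[OF summable_J_prod[OF s0(2) conv]] by (simp add: tendsto_norm_zero_iff)
    ultimately show ?thesis
      by (auto simp: Bseq_def intro!: lim_null_mult_right_bounded eventuallyI)
  qed
qed

lemma laplace_series:
  assumes sol: "solves f u" and s: "regular s" and conv: "r = 1 \<Longrightarrow> norm (J_sum s) < 1"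
  shows "(\<lambda>k. J_prod k s * (laplace_transform f (s / of_real (r ^ k))
       - coef1 (s / of_real (r ^ k)) * laplace_transform u (of_real \<mu>)
       - coef2 (s / of_real (r ^ k)) * laplace_transform u (of_real (2 * \<mu>)))) sums laplace_transform u s"
  unfolding sums_def partial_sums[OF sol s]
  using tendsto_diff[OF tendsto_const remainder_tendsto_0[OF assms]] by simp

end

section \<open>The ruin probability\<close>

text \<open>The only candidate for the time of hitting 0 is the level \<open>u\<close> itself, and
  \<open>u \<le> c u + b\<close> is \<open>(1 - c) u \<le> b\<close>.\<close>

lemma ruined_iff:
  "ruined a c b y x \<longleftrightarrow> (\<exists>n. 0 \<le> level_after a c b y x n \<and> (1 - c) * level_after a c b y x n \<le> b n)"
  unfolding ruined_def interarrival_def by (auto simp: algebra_simps)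

text \<open>The recursion appends gains at the end; conditioning on the first gain needs it peeled
  off at the front.\<close>

lemma level_after_Suc_shift:
  "level_after a c b y x (Suc n) =
     level_after a c (\<lambda>k. b (Suc k)) (\<lambda>k. y (Suc k)) ((1 + a) * ((1 - c) * x - b 0) + y 0) n"
  by (induction n) (simp_all add: interarrival_def algebra_simps)

lemma ruined_first_step:
  assumes "0 \<le> x"
  shows "ruined a c b y x \<longleftrightarrow> (1 - c) * x \<le> b 0 \<or>
     ruined a c (\<lambda>k. b (Suc k)) (\<lambda>k. y (Suc k)) ((1 + a) * ((1 - c) * x - b 0) + y 0)"
proof -
  have "(\<exists>n. P n) \<longleftrightarrow> P 0 \<or> (\<exists>n. P (Suc n))" for P :: "nat \<Rightarrow> bool"
    by (metis not0_implies_Suc)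
  from this[of "\<lambda>n. 0 \<le> level_after a c b y x n \<and> (1 - c) * level_after a c b y x n \<le> b n"]
  show ?thesis
    unfolding ruined_iff level_after_Suc_shift using assms by simp
qed

context fgm_dual_risk
begin

abbreviation S :: "(nat \<Rightarrow> real \<times> real) measure" where
  "S \<equiv> \<Pi>\<^sub>M i\<in>(UNIV::nat set). N"

abbreviation ruined_on :: "real \<Rightarrow> (nat \<Rightarrow> real \<times> real) \<Rightarrow> bool" where
  "ruined_on x w \<equiv> ruined a c (\<lambda>n. fst (w n)) (\<lambda>n. snd (w n)) x"

text \<open>Ruin in the canonical model, on sequences of pairs under the product law. There the
  first coordinate can be split off and the rest shifted; \<open>ruin_prob_eq_ruin\<close> returns
  to an arbitrary probability space.\<close>

definition ruin :: "real \<Rightarrow> real" where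
  "ruin x = measure S {w. ruined_on x w}"

lemma space_S [simp]: "space S = UNIV"
  by (simp add: space_PiM)

sublocale SS: sequence_space N
  by unfold_locales

lemma measurable_level [measurable]:
  "(\<lambda>p. level_after a c (\<lambda>n. fst (snd p n)) (\<lambda>n. snd (snd p n)) (fst p) k) \<in> borel_measurable (borel \<Otimes>\<^sub>M S)"
proof (induction k)
  case (Suc k)
  have "(\<lambda>p. snd p k) \<in> (borel \<Otimes>\<^sub>M S) \<rightarrow>\<^sub>M N"
    by measurable
  then have m: "(\<lambda>p. snd p k) \<in> (borel \<Otimes>\<^sub>M S) \<rightarrow>\<^sub>M (borel \<Otimes>\<^sub>M borel)"
    by (simp only: borel_prod measurable_cong_sets[OF refl sets_N])
  have [measurable]: "(\<lambda>p. fst (snd p k)) \<in> borel_measurable (borel \<Otimes>\<^sub>M S)"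
      "(\<lambda>p. snd (snd p k)) \<in> borel_measurable (borel \<Otimes>\<^sub>M S)"
    using measurable_compose[OF m measurable_fst] measurable_compose[OF m measurable_snd] by auto
  note Suc[measurable]
  show ?case unfolding level_after.simps interarrival_def by measurable
qed simp

lemma measurable_fst_component [measurable]:
  "(\<lambda>w. fst (w k)) \<in> borel_measurable S" "(\<lambda>p. fst (snd p k)) \<in> borel_measurable (borel \<Otimes>\<^sub>M S)"
proof -
  have "(\<lambda>w. w k) \<in> S \<rightarrow>\<^sub>M N" by measurable
  then have m: "(\<lambda>w. w k) \<in> S \<rightarrow>\<^sub>M (borel \<Otimes>\<^sub>M borel)"
    by (simp only: borel_prod measurable_cong_sets[OF refl sets_N])
  show *: "(\<lambda>w. fst (w k)) \<in> borel_measurable S"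
    using measurable_compose[OF m measurable_fst] by simp
  show "(\<lambda>p. fst (snd p k)) \<in> borel_measurable (borel \<Otimes>\<^sub>M S)"
    by (rule measurable_compose[OF measurable_snd *])
qed

lemma sets_ruined_pair: "{p. ruined_on (fst p) (snd p)} \<in> sets (borel \<Otimes>\<^sub>M S)"
proof -
  have "{p \<in> space (borel \<Otimes>\<^sub>M S). ruined_on (fst p) (snd p)} \<in> sets (borel \<Otimes>\<^sub>M S)"
    unfolding ruined_iff by measurable
  then show ?thesis by (simp add: space_pair_measure)
qed

lemma sets_ruined [measurable]: "{w. ruined_on x w} \<in> sets S"
  using sets_Pair1[OF sets_ruined_pair, of x] by (simp add: vimage_def)

lemma measurable_ruin [measurable]: "ruin \<in> borel_measurable borel"
proof -
  have "(\<lambda>x. emeasure S (Pair x -` {p. ruined_on (fst p) (snd p)})) \<in> borel_measurable borel"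
    using sets_ruined_pair by (rule SS.P.measurable_emeasure_Pair)
  then show ?thesis
    unfolding ruin_def[abs_def] measure_def by (simp add: vimage_def)
qed

lemma ruin_nonneg: "0 \<le> ruin x"
  by (simp add: ruin_def)

lemma ruin_le_1: "ruin x \<le> 1"
  unfolding ruin_def by (rule SS.P.prob_le_1)

text \<open>First-step analysis: prepending an independent pair to a sequence preserves the product
  law, so the probability of ruin can be computed by integrating over the first pair.\<close>

lemma ruin_integral_equation:
  assumes x: "0 \<le> x"
  shows "ruin x = exp (- lam * x * d) + gain_op ruin x"
proof -
  let ?E = "{w. ruined_on x w}"
  let ?f = "\<lambda>(z, w). case_nat z w :: nat \<Rightarrow> real \<times> real"
  have "closed {z :: real \<times> real. d * x \<le> fst z}" by (intro closed_Collect_le continuous_intros)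
  then have ms: "{z. d * x \<le> fst z} \<in> sets N" by (simp only: sets_N borel_closed)
  have indi: "integrable N (indicat_real {z. d * x \<le> fst z})"
    by (rule integrable_real_indicator[OF ms]) (simp add: N.emeasure_eq_measure)
  have mf: "?f \<in> N \<Otimes>\<^sub>M S \<rightarrow>\<^sub>M S" by measurable
  have "emeasure S ?E = emeasure (distr (N \<Otimes>\<^sub>M S) S ?f) ?E"
    by (simp only: SS.PiM_iter)
  also have "\<dots> = emeasure (N \<Otimes>\<^sub>M S) (?f -` ?E \<inter> space (N \<Otimes>\<^sub>M S))"
    by (rule emeasure_distr[OF mf sets_ruined])
  also have "\<dots> = (\<integral>\<^sup>+z. emeasure S (Pair z -` (?f -` ?E \<inter> space (N \<Otimes>\<^sub>M S))) \<partial>N)"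
    by (rule SS.P.emeasure_pair_measure_alt) (rule measurable_sets[OF mf sets_ruined])
  also have "\<dots> = (\<integral>\<^sup>+z. ennreal (indicator {z. d * x \<le> fst z} z + gain_kernel ruin x z) \<partial>N)"
  proof (rule nn_integral_cong_AE)
    show "AE z in N. emeasure S (Pair z -` (?f -` ?E \<inter> space (N \<Otimes>\<^sub>M S)))
        = ennreal (indicator {z. d * x \<le> fst z} z + gain_kernel ruin x z)"
      using AE_N_nonneg
    proof eventually_elim
      case (elim z)
      \<comment> \<open>The fibre over \<open>z\<close> is everything if 0 is hit no later than the
        first gain; otherwise it is the ruin event from the level after that gain.\<close>
      have "Pair z -` (?f -` ?E \<inter> space (N \<Otimes>\<^sub>M S)) =
          {w. d * x \<le> fst z \<or> ruined_on (g * (d * x - fst z) + snd z) w}"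
        by (auto simp: ruined_first_step[OF x] space_pair_measure d_def g_def)
      then show ?case
        using elim SS.P.emeasure_space_1
        by (auto simp: gain_kernel_def ruin_def SS.P.emeasure_eq_measure)
    qed
  qed
  also have "\<dots> = ennreal (\<integral>z. indicator {z. d * x \<le> fst z} z + gain_kernel ruin x z \<partial>N)"
  proof (rule nn_integral_eq_integral)
    show "integrable N (\<lambda>z. indicator {z. d * x \<le> fst z} z + gain_kernel ruin x z)"
      using indi integrable_gain_kernel[of ruin 1 x] ruin_nonneg ruin_le_1 by simp
    show "AE z in N. 0 \<le> indicator {z. d * x \<le> fst z} z + gain_kernel ruin x z"
      using ruin_nonneg by (auto simp: gain_kernel_def)
  qed
  also have "(\<integral>z. indicator {z. d * x \<le> fst z} z + gain_kernel ruin x z \<partial>N)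
      = exp (- lam * x * d) + gain_op ruin x"
    using indi integrable_gain_kernel[of ruin 1 x] ruin_nonneg ruin_le_1 prob_interarrival_ge[of "d * x"] x pos
    by (simp add: gain_op_def mult_ac)
  finally have "ennreal (ruin x) = ennreal (exp (- lam * x * d) + gain_op ruin x)"
    by (simp add: ruin_def SS.P.emeasure_eq_measure)
  moreover have "0 \<le> gain_op ruin x"
    unfolding gain_op_def using ruin_nonneg by (intro Bochner_Integration.integral_nonneg) (simp add: gain_kernel_def)
  ultimately show ?thesis
    using ruin_nonneg[of x] by (subst (asm) ennreal_inj) auto
qed

section \<open>Decay of the ruin probability at high levels\<close>

text \<open>Dropping the nonnegative gain sizes leaves the recursion that sends \<open>v\<close> to
  \<open>r v - g b\<close>; dividing by powers of \<open>r\<close> sums it, and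
  \<open>g / r = 1 / d\<close> explains the denominator.\<close>

lemma level_lower_bound:
  assumes "\<And>n. 0 \<le> y n"
  shows "r ^ n * (x - (\<Sum>k<n. b k / r ^ k) / d) \<le> level_after a c b y x n"
proof (induction n)
  case (Suc n)
  have "r ^ Suc n * (x - (\<Sum>k<Suc n. b k / r ^ k) / d)
      = r * (r ^ n * (x - (\<Sum>k<n. b k / r ^ k) / d)) - g * b n"
    using pos by (simp add: r_def field_simps)
  also have "\<dots> \<le> r * level_after a c b y x n - g * b n + y n"
    using mult_left_mono[OF Suc, of r] pos assms[of n] by linarith
  also have "\<dots> = level_after a c b y x (Suc n)"
    by (simp add: interarrival_def r_def d_def g_def algebra_simps)
  finally show ?case .
qed simp

text \<open>Ruin from \<open>x\<close> forces the discounted sum \<open>W\<close> to reach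
  \<open>d x\<close>. The mean of \<open>W\<close> is a geometric series, finite for
  \<open>1 < r\<close>, so Markov's inequality bounds the probability by a multiple of
  \<open>1 / x\<close>.\<close>

lemma ruin_tendsto_0:
  assumes r: "1 < r"
  shows "(ruin \<longlongrightarrow> 0) at_top"
proof -
  define W where "W w = (\<Sum>n. ennreal (fst (w n) / r ^ n))" for w :: "nat \<Rightarrow> real \<times> real"
  have [measurable]: "W \<in> borel_measurable S"
    unfolding W_def[abs_def] by measurable
  have AES: "AE w in S. \<forall>n. 0 \<le> fst (w n) \<and> 0 \<le> snd (w n)"
    unfolding AE_all_countable by (intro allI AE_PiM_component prob_space_N AE_N_nonneg) auto
  obtain m where m: "0 \<le> m" "(\<integral>\<^sup>+z. ennreal (fst z) \<partial>N) = ennreal m"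
    using nn_integral_interarrival_finite by (auto simp: less_top_ennreal)
  have comp: "(\<integral>\<^sup>+w. ennreal (fst (w n) / r ^ n) \<partial>S) = ennreal (m * (1 / r) ^ n)" for n
  proof -
    have [measurable]: "(\<lambda>z. fst z :: real) \<in> borel_measurable N"
      by (simp add: borel_prod[symmetric] cong: measurable_cong_sets)
    have "(\<integral>\<^sup>+w. ennreal (fst (w n) / r ^ n) \<partial>S) = (\<integral>\<^sup>+z. ennreal (fst z / r ^ n) \<partial>distr S N (\<lambda>w. w n))"
      by (subst nn_integral_distr) auto
    also have "distr S N (\<lambda>w. w n) = N"
      by (rule distr_PiM_component) (auto intro: prob_space_N)
    also have "(\<integral>\<^sup>+z. ennreal (fst z / r ^ n) \<partial>N) = (\<integral>\<^sup>+z. ennreal (1 / r ^ n) * ennreal (fst z) \<partial>N)"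
      using r AE_N_nonneg by (intro nn_integral_cong_AE) (auto simp flip: ennreal_mult)
    also have "\<dots> = ennreal (m * (1 / r) ^ n)"
      using r m by (simp add: nn_integral_cmult power_divide flip: ennreal_mult)
    finally show ?thesis .
  qed
  have "(\<integral>\<^sup>+w. W w \<partial>S) = (\<Sum>n. ennreal (m * (1 / r) ^ n))"
    unfolding W_def by (subst nn_integral_suminf) (auto simp: comp)
  also have "\<dots> = ennreal (m * (1 / (1 - 1 / r)))"
    using r m by (intro suminf_ennreal_eq sums_mult geometric_sums) auto
  finally obtain C where C: "0 \<le> C" "(\<integral>\<^sup>+w. W w \<partial>S) = ennreal C"
    using m r by (metis diff_ge_0_iff_ge divide_le_eq_1_pos less_eq_real_def mult_nonneg_nonneg order_less_trans zero_le_divide_1_iff zero_less_one)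
  have le: "ennreal (d * x) \<le> W w"
    if "\<forall>n. 0 \<le> fst (w n) \<and> 0 \<le> snd (w n)" "ruined_on x w" for x w
  proof -
    from that(2) obtain n where n: "d * level_after a c (\<lambda>n. fst (w n)) (\<lambda>n. snd (w n)) x n \<le> fst (w n)"
      unfolding ruined_iff d_def by auto
    have rn: "0 < r ^ n" using pos by simp
    have "r ^ n * (x - (\<Sum>k<n. fst (w k) / r ^ k) / d) \<le> level_after a c (\<lambda>n. fst (w n)) (\<lambda>n. snd (w n)) x n"
      by (rule level_lower_bound) (use that in auto)
    from mult_left_mono[OF this, of d] n pos
    have "d * (r ^ n * (x - (\<Sum>k<n. fst (w k) / r ^ k) / d)) \<le> fst (w n)" by linarith
    also have "d * (r ^ n * (x - (\<Sum>k<n. fst (w k) / r ^ k) / d)) = (d * x - (\<Sum>k<n. fst (w k) / r ^ k)) * r ^ n"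
      using pos by (simp add: right_diff_distrib left_diff_distrib mult_ac)
    finally have "d * x - (\<Sum>k<n. fst (w k) / r ^ k) \<le> fst (w n) / r ^ n"
      using rn by (simp only: pos_le_divide_eq)
    \<comment> \<open>The delay during which ruin occurs supplies the last term of the sum.\<close>
    then have "d * x \<le> (\<Sum>k<Suc n. fst (w k) / r ^ k)" by simp
    then have "ennreal (d * x) \<le> ennreal (\<Sum>k<Suc n. fst (w k) / r ^ k)" by (rule ennreal_leI)
    also have "\<dots> = (\<Sum>k<Suc n. ennreal (fst (w k) / r ^ k))"
      using that(1) r by (intro sum_ennreal[symmetric]) auto
    also have "\<dots> \<le> W w"
      unfolding W_def by (rule sum_le_suminf) auto
    finally show ?thesis .
  qed
  have bound: "ruin x \<le> C / (d * x)" if x: "0 < x" for x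
  proof -
    have dx: "0 < d * x" using x pos by simp
    have "emeasure S {w. ruined_on x w} \<le> emeasure S {w \<in> UNIV. 1 \<le> ennreal (1 / (d * x)) * W w}"
    proof (rule emeasure_mono_AE)
      show "AE w in S. w \<in> {w. ruined_on x w} \<longrightarrow> w \<in> {w \<in> UNIV. 1 \<le> ennreal (1 / (d * x)) * W w}"
        using AES
      proof eventually_elim
        case (elim w)
        show ?case
        proof (intro impI CollectI conjI UNIV_I)
          assume "w \<in> {w. ruined_on x w}"
          then have "ruined_on x w" by simp
          from mult_left_mono[OF le[OF elim this], of "ennreal (1 / (d * x))"] dx pos x
          show "1 \<le> ennreal (1 / (d * x)) * W w" by (simp flip: ennreal_mult)
        qed
      qed
      have "{w \<in> space S. 1 \<le> ennreal (1 / (d * x)) * W w} \<in> sets S" by measurable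
      then show "{w \<in> UNIV. 1 \<le> ennreal (1 / (d * x)) * W w} \<in> sets S" by simp
    qed
    also have "\<dots> \<le> ennreal (1 / (d * x)) * (\<integral>\<^sup>+w. W w * indicator UNIV w \<partial>S)"
      using nn_integral_Markov_inequality[of W UNIV S] sets.top[of S] by simp
    also have "\<dots> = ennreal (C / (d * x))"
      using C dx by (simp flip: ennreal_mult)
    finally show ?thesis
      using C dx by (simp add: ruin_def SS.P.emeasure_eq_measure)
  qed
  show ?thesis
  proof (rule tendsto_sandwich[of "\<lambda>_. 0"])
    show "\<forall>\<^sub>F x in at_top. ruin x \<le> C / (d * x)"
      using eventually_gt_at_top[of 0] by eventually_elim (rule bound)
    show "((\<lambda>x. C / (d * x)) \<longlongrightarrow> 0) at_top"
      using pos by (intro tendsto_divide_0[OF tendsto_const] filterlim_at_top_imp_at_infinity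
          filterlim_tendsto_pos_mult_at_top[OF tendsto_const _ filterlim_ident])
  qed (auto simp: ruin_nonneg)
qed

lemma solves_ruin: "solves (\<lambda>x. exp (- lam * x * d)) ruin"
proof -
  have "\<bar>exp (- lam * x * d)\<bar> \<le> 1 \<and> \<bar>ruin x\<bar> \<le> 1" if "0 \<le> x" for x
    using that lam pos ruin_nonneg[of x] ruin_le_1[of x] by simp
  moreover have "(\<lambda>x. exp (- lam * x * d)) \<in> borel_measurable borel" by measurable
  ultimately show ?thesis
    unfolding solves_def using ruin_tendsto_0 ruin_integral_equation measurable_ruin by blast
qed

end

section \<open>Uniqueness of the unknown transform values\<close>

text \<open>After division by \<open>T^N\<close> the terms with \<open>\<tau> k < T\<close> decay
  and those with \<open>\<tau> k = T\<close> do not move. Tannery's theorem with the majorant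
  \<open>norm (w k)\<close> exchanges limit and sum.\<close>

lemma geometric_mixture_tendsto:
  fixes w :: "nat \<Rightarrow> complex" and \<tau> :: "nat \<Rightarrow> real"
  assumes w: "summable (\<lambda>k. norm (w k))" and T: "0 < T" and \<tau>: "\<And>k. 0 \<le> \<tau> k" "\<And>k. \<tau> k \<le> T"
  shows "(\<lambda>N. (\<Sum>k. w k * of_real (\<tau> k) ^ N) / of_real T ^ N) \<longlonglongrightarrow> (\<Sum>k. if \<tau> k = T then w k else 0)"
proof -
  define a where "a k N = w k * of_real ((\<tau> k / T) ^ N)" for k N
  have "(\<lambda>N. \<Sum>k. a k N) \<longlonglongrightarrow> (\<Sum>k. if \<tau> k = T then w k else 0)"
  proof (rule tannerys_theorem[THEN conjunct2, THEN conjunct2])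
    fix k
    show "(\<lambda>N. a k N) \<longlonglongrightarrow> (if \<tau> k = T then w k else 0)"
    proof (cases "\<tau> k = T")
      case False
      then have "(\<lambda>N. w k * of_real ((\<tau> k / T) ^ N)) \<longlonglongrightarrow> w k * of_real 0"
        using T \<tau>[of k] by (intro tendsto_intros LIMSEQ_realpow_zero) auto
      then show ?thesis using False by (simp add: a_def)
    qed (use T in \<open>simp add: a_def\<close>)
  next
    have "norm (a k N) \<le> norm (w k)" for k N
    proof -
      have "norm (w k) * (\<tau> k / T) ^ N \<le> norm (w k) * 1"
        using T \<tau>[of k] by (intro mult_left_mono power_le_one) auto
      then show ?thesis using T \<tau>[of k] by (simp add: a_def norm_mult norm_power norm_divide power_divide)
    qed
    then show "\<forall>\<^sub>F (k, N) in at_top \<times>\<^sub>F sequentially. norm (a k N) \<le> norm (w k)"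
      by (intro always_eventually) auto
  qed (use w in auto)
  moreover have "(\<Sum>k. a k N) = (\<Sum>k. w k * of_real (\<tau> k) ^ N) / of_real T ^ N" for N
  proof -
    have "summable (\<lambda>k. w k * of_real (\<tau> k) ^ N)"
    proof (rule summable_comparison_test'[where N = 0])
      show "summable (\<lambda>k. norm (w k) * T ^ N)" using w by (rule summable_mult2)
      show "norm (w k * of_real (\<tau> k) ^ N) \<le> norm (w k) * T ^ N" for k
        using \<tau>[of k] by (simp add: norm_mult norm_power mult_left_mono power_mono)
    qed
    from suminf_divide[OF this, of "of_real T ^ N"]
    show ?thesis by (simp add: a_def power_divide)
  qed
  ultimately show ?thesis by simp
qed

text \<open>\<open>\<tau> 0\<close> strictly exceeds every other base in both series, so division by
  its powers isolates \<open>\<alpha> * w 0\<close>. Once \<open>\<alpha> = 0\<close>, the same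
  argument with \<open>\<tau>' 0\<close> gives \<open>\<beta> = 0\<close>.\<close>

lemma geometric_mixtures_independent:
  fixes w w' :: "nat \<Rightarrow> complex" and \<tau> \<tau>' :: "nat \<Rightarrow> real"
  assumes w: "summable (\<lambda>k. norm (w k))" "w 0 \<noteq> 0" and w': "summable (\<lambda>k. norm (w' k))" "w' 0 \<noteq> 0"
    and nn: "\<And>k. 0 \<le> \<tau> k" "\<And>k. 0 \<le> \<tau>' k"
    and less: "\<And>k. 0 < k \<Longrightarrow> \<tau> k < \<tau> 0" "\<And>k. \<tau>' k < \<tau> 0" "\<And>k. 0 < k \<Longrightarrow> \<tau>' k < \<tau>' 0"
    and zero: "\<And>N. \<alpha> * (\<Sum>k. w k * of_real (\<tau> k) ^ N) + \<beta> * (\<Sum>k. w' k * of_real (\<tau>' k) ^ N) = 0"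
  shows "\<alpha> = 0" "\<beta> = 0"
proof -
  have single: "(\<Sum>k. if v k = v (0::nat) then x k else 0) = x 0"
    if "\<And>k. 0 < k \<Longrightarrow> v k < v 0" for v :: "nat \<Rightarrow> real" and x :: "nat \<Rightarrow> complex"
  proof -
    have "(\<lambda>k. if v k = v 0 then x k else 0) = (\<lambda>k. if k = 0 then x k else 0)"
      using that by (auto simp: fun_eq_iff) (metis gr0I less_irrefl)
    then show ?thesis using sums_single[of 0 x] by (simp add: sums_unique[symmetric])
  qed
  \<comment> \<open>Positivity comes from the nonnegative base of index 1, which lies strictly
    below.\<close>
  have T: "0 < \<tau> 0" "0 < \<tau>' 0"
    using nn(1)[of 1] less(1)[of 1] nn(2)[of 1] less(3)[of 1] by auto
  have le: "\<tau> k \<le> \<tau> 0" "\<tau>' k \<le> \<tau> 0" "\<tau>' k \<le> \<tau>' 0" for k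
    using less(1)[of k] less(2)[of k] less(3)[of k] by (cases "k = 0"; force)+
  have lim: "(\<lambda>N. \<alpha> * ((\<Sum>k. w k * of_real (\<tau> k) ^ N) / of_real (\<tau> 0) ^ N)
      + \<beta> * ((\<Sum>k. w' k * of_real (\<tau>' k) ^ N) / of_real (\<tau> 0) ^ N))
    \<longlonglongrightarrow> \<alpha> * (\<Sum>k. if \<tau> k = \<tau> 0 then w k else 0) + \<beta> * (\<Sum>k. if \<tau>' k = \<tau> 0 then w' k else 0)"
    using w w' T nn le by (intro tendsto_intros geometric_mixture_tendsto) auto
  have s0: "(\<Sum>k. if \<tau>' k = \<tau> 0 then w' k else 0) = 0"
    using less(2) by (auto simp: less_le)
  have eq: "\<alpha> * ((\<Sum>k. w k * of_real (\<tau> k) ^ N) / of_real (\<tau> 0) ^ N)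
      + \<beta> * ((\<Sum>k. w' k * of_real (\<tau>' k) ^ N) / of_real (\<tau> 0) ^ N) = 0" for N
    using zero[of N] by (simp add: add_divide_distrib[symmetric])
  have s1: "(\<Sum>k. if \<tau> k = \<tau> 0 then w k else 0) = w 0" "(\<Sum>k. if \<tau>' k = \<tau>' 0 then w' k else 0) = w' 0"
    by (rule single, erule less)+
  have "\<alpha> * w 0 = 0"
    using lim unfolding eq s0 s1 by (simp add: LIMSEQ_const_iff)
  then show \<alpha>: "\<alpha> = 0" using w by simp
  have lim': "(\<lambda>N. \<beta> * ((\<Sum>k. w' k * of_real (\<tau>' k) ^ N) / of_real (\<tau>' 0) ^ N))
    \<longlonglongrightarrow> \<beta> * (\<Sum>k. if \<tau>' k = \<tau>' 0 then w' k else 0)"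
    using w' T nn le by (intro tendsto_intros geometric_mixture_tendsto) auto
  have eq': "\<beta> * ((\<Sum>k. w' k * of_real (\<tau>' k) ^ N) / of_real (\<tau>' 0) ^ N) = 0" for N
    using zero[of N] \<alpha> by simp
  have "\<beta> * w' 0 = 0"
    using lim' unfolding eq' s1 by (simp add: LIMSEQ_const_iff)
  then show "\<beta> = 0" using w' by simp
qed

text \<open>A nonzero vector killed from the right makes the determinant vanish, which in turn
  provides a nonzero vector killed from the left. The uniqueness proof passes to the dual system in
  this way.\<close>

lemma left_null_vector_2x2:
  fixes a b c d p q :: "'a::field"
  assumes "a * p + b * q = 0" "c * p + d * q = 0" "p \<noteq> 0 \<or> q \<noteq> 0"
  obtains x y where "x \<noteq> 0 \<or> y \<noteq> 0" "x * a + y * c = 0" "x * b + y * d = 0"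
proof -
  have "(a * d - b * c) * p = d * (a * p + b * q) - b * (c * p + d * q)"
    "(a * d - b * c) * q = a * (c * p + d * q) - c * (a * p + b * q)"
    by (simp_all add: algebra_simps)
  then have det: "a * d - b * c = 0" using assms by auto
  show thesis
  proof (cases "a = 0 \<and> c = 0")
    case True
    show thesis
    proof (cases "b = 0 \<and> d = 0")
      case True
      then show thesis using \<open>a = 0 \<and> c = 0\<close> by (intro that[of 1 0]) auto
    next
      case False
      then show thesis using True by (intro that[of d "- b"]) auto
    qed
  next
    case False
    \<comment> \<open>\<open>(c, - a)\<close> kills the first column identically and the second by
      the vanishing determinant.\<close>
    then show thesis using det by (intro that[of c "- a"]) (auto simp: algebra_simps)
  qed
qed

context fgm_dual_risk
begin

section \<open>Solvability for forcings dominated by the no-gain probability\<close>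

lemma gain_op_linear:
  assumes u: "u \<in> borel_measurable borel" "\<And>x. 0 \<le> x \<Longrightarrow> \<bar>u x\<bar> \<le> M"
    and v: "v \<in> borel_measurable borel" "\<And>x. 0 \<le> x \<Longrightarrow> \<bar>v x\<bar> \<le> M'"
  shows "gain_op (\<lambda>x. u x + k * v x) x = gain_op u x + k * gain_op v x"
proof -
  have "gain_kernel (\<lambda>x. u x + k * v x) x = (\<lambda>z. gain_kernel u x z + k * gain_kernel v x z)"
    by (auto simp: gain_kernel_def fun_eq_iff)
  then show ?thesis
    unfolding gain_op_def using integrable_gain_kernel[OF u, of x] integrable_gain_kernel[OF v, of x] by simp
qed

lemma gain_op_mono:
  assumes u: "u \<in> borel_measurable borel" "\<And>x. 0 \<le> x \<Longrightarrow> \<bar>u x\<bar> \<le> M"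
    and v: "v \<in> borel_measurable borel" "\<And>x. 0 \<le> x \<Longrightarrow> \<bar>v x\<bar> \<le> M'"
    and le: "\<And>x. 0 \<le> x \<Longrightarrow> u x \<le> v x"
  shows "gain_op u x \<le> gain_op v x"
  unfolding gain_op_def
proof (rule integral_mono)
  show "integrable N (gain_kernel u x)" "integrable N (gain_kernel v x)"
    using integrable_gain_kernel[OF u] integrable_gain_kernel[OF v] by auto
  fix z
  have "0 \<le> g * (d * x - fst z) + snd z" if "0 \<le> fst z \<and> fst z < d * x \<and> 0 \<le> snd z"
    using that pos by (intro add_nonneg_nonneg mult_nonneg_nonneg) auto
  then show "gain_kernel u x z \<le> gain_kernel v x z"
    using le by (auto simp: gain_kernel_def)
qed

lemma solves_linear:
  assumes "solves f u" "solves h v"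
  shows "solves (\<lambda>x. f x + k * h x) (\<lambda>x. u x + k * v x)"
proof -
  obtain M where f: "f \<in> borel_measurable borel" "u \<in> borel_measurable borel"
    "\<And>x. 0 \<le> x \<Longrightarrow> \<bar>f x\<bar> \<le> M" "\<And>x. 0 \<le> x \<Longrightarrow> \<bar>u x\<bar> \<le> M"
    "\<And>x. 0 \<le> x \<Longrightarrow> u x = f x + gain_op u x" "1 < r \<Longrightarrow> (u \<longlongrightarrow> 0) at_top"
    using solvesE[OF assms(1)] by blast
  obtain M' where h: "h \<in> borel_measurable borel" "v \<in> borel_measurable borel"
    "\<And>x. 0 \<le> x \<Longrightarrow> \<bar>h x\<bar> \<le> M'" "\<And>x. 0 \<le> x \<Longrightarrow> \<bar>v x\<bar> \<le> M'"
    "\<And>x. 0 \<le> x \<Longrightarrow> v x = h x + gain_op v x" "1 < r \<Longrightarrow> (v \<longlongrightarrow> 0) at_top"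
    using solvesE[OF assms(2)] by blast
  have bd: "\<bar>p + k * q\<bar> \<le> M + \<bar>k\<bar> * M'" if "\<bar>p\<bar> \<le> M" "\<bar>q\<bar> \<le> M'" for p q
    using that abs_triangle_ineq[of p "k * q"] mult_left_mono[OF that(2), of "\<bar>k\<bar>"] by (simp add: abs_mult)
  have meas: "(\<lambda>x. f x + k * h x) \<in> borel_measurable borel" "(\<lambda>x. u x + k * v x) \<in> borel_measurable borel"
    using f(1,2) h(1,2) by measurable
  have eq: "u x + k * v x = f x + k * h x + gain_op (\<lambda>x. u x + k * v x) x" if "0 \<le> x" for x
  proof -
    have "gain_op (\<lambda>x. u x + k * v x) x = gain_op u x + k * gain_op v x"
      by (rule gain_op_linear) (use f(1-4) h(1-4) in auto)
    moreover have "k * v x = k * h x + k * gain_op v x"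
      using h(5)[OF that] by (simp only: distrib_left)
    ultimately show ?thesis using f(5)[OF that] by linarith
  qed
  have lim: "((\<lambda>x. u x + k * v x) \<longlongrightarrow> 0) at_top" if "1 < r"
    using tendsto_add[OF f(6)[OF that] tendsto_mult[OF tendsto_const[of k] h(6)[OF that]]] by simp
  show ?thesis
    by (rule solvesI[OF meas bd bd eq lim]) (use f(3,4) h(3,4) in auto)
qed

text \<open>Monotone iteration from 0. Since \<open>M * ruin\<close> solves the equation with
  forcing \<open>M * exp (- lam * x * d)\<close>, it dominates every iterate, which yields
  convergence and, for \<open>1 < r\<close>, decay at infinity.\<close>

lemma ex_solves_nonneg:
  assumes f [measurable]: "f \<in> borel_measurable borel"
    and bd: "\<And>x. 0 \<le> x \<Longrightarrow> 0 \<le> f x" "\<And>x. 0 \<le> x \<Longrightarrow> f x \<le> M * exp (- lam * x * d)"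
  shows "\<exists>u. solves f u"
proof -
  define v where "v n = ((\<lambda>u x. f x + gain_op u x) ^^ n) (\<lambda>_. 0)" for n
  have v0fun: "v 0 = (\<lambda>_. 0)" by (simp add: v_def)
  have vS: "v (Suc n) x = f x + gain_op (v n) x" for n x by (simp add: v_def)
  have vm [measurable]: "v n \<in> borel_measurable borel" for n
    by (induction n) (simp_all add: v_def)
  have "0 \<le> M * exp (- lam * 0 * d)" using bd(1)[of 0] bd(2)[of 0] by linarith
  then have M0: "0 \<le> M" by simp
  have Mr: "\<bar>M * ruin x\<bar> \<le> M" for x
    using M0 ruin_nonneg[of x] ruin_le_1[of x] mult_left_mono[of "ruin x" 1 M] by simp
  have Mrm [measurable]: "(\<lambda>x. M * ruin x) \<in> borel_measurable borel" by measurable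
  have gMr: "gain_op (\<lambda>x. M * ruin x) x = M * gain_op ruin x" for x
    using gain_op_linear[of "\<lambda>_. 0" 0 ruin 1 M x] ruin_nonneg ruin_le_1
    by (simp add: gain_op_def gain_kernel_def)
  have gain0: "gain_op (\<lambda>_. 0) x = 0" for x
    by (simp add: gain_op_def gain_kernel_def)
  have vb: "0 \<le> v n x \<and> v n x \<le> M * ruin x \<and> v n x \<le> v (Suc n) x" if "0 \<le> x" for n x
    using that
  proof (induction n arbitrary: x)
    case 0
    then show ?case
      using bd(1) M0 ruin_nonneg by (simp only: vS v0fun gain0) simp
  next
    case (Suc n)
    have b: "0 \<le> x \<Longrightarrow> \<bar>v n x\<bar> \<le> M" for x
      using Suc.IH[of x] Mr[of x] by linarith
    have le2: "v n x \<le> v (Suc n) x" "0 \<le> v n x" if "0 \<le> x" for x using Suc.IH[OF that] by auto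
    have le1: "v (Suc n) x \<le> M * ruin x" if "0 \<le> x" for x
    proof -
      have "gain_op (v n) x \<le> gain_op (\<lambda>x. M * ruin x) x"
        by (rule gain_op_mono[where M = M and M' = M]) (use b Mr Suc.IH in auto)
      moreover have "M * ruin x = M * exp (- lam * x * d) + M * gain_op ruin x"
        using ruin_integral_equation[OF that] by (simp only: distrib_left)
      ultimately show ?thesis
        using bd(2)[OF that] unfolding vS gMr by linarith
    qed
    have b': "0 \<le> x \<Longrightarrow> \<bar>v (Suc n) x\<bar> \<le> M" for x
      using le1[of x] le2[of x] Mr[of x] by linarith
    have "gain_op (v n) x \<le> gain_op (v (Suc n)) x"
      by (rule gain_op_mono[where M = M and M' = M]) (use b b' le2 in auto)
    then have "v (Suc n) x \<le> v (Suc (Suc n)) x" by (simp only: vS)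
    then show ?case using le1[OF Suc.prems] le2[OF Suc.prems] by linarith
  qed
  have vM: "0 \<le> x \<Longrightarrow> \<bar>v n x\<bar> \<le> M" for x n using vb[of x n] Mr[of x] by linarith
  \<comment> \<open>The indicator makes the sequence zero, hence convergent, on the negative axis,
    about which the bounds say nothing.\<close>
  define u where "u x = lim (\<lambda>n. indicator {0..} x * v n x)" for x
  have um [measurable]: "u \<in> borel_measurable borel"
    unfolding u_def[abs_def] by measurable
  have conv: "(\<lambda>n. v n x) \<longlonglongrightarrow> u x" if x: "0 \<le> x" for x
  proof -
    have "convergent (\<lambda>n. v n x)"
    proof (rule Bseq_mono_convergent)
      show "Bseq (\<lambda>n. v n x)"
        by (rule BseqI'[of _ M]) (use vM[OF x] in auto)
      show "\<forall>m. \<forall>n\<ge>m. v m x \<le> v n x"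
        using vb[OF x] by (auto intro: lift_Suc_mono_le)
    qed
    then show ?thesis using x by (simp add: u_def convergent_LIMSEQ_iff)
  qed
  have ub: "0 \<le> u x" "u x \<le> M * ruin x" if x: "0 \<le> x" for x
  proof -
    show "0 \<le> u x" by (rule LIMSEQ_le_const[OF conv[OF x]]) (use vb[OF x] in auto)
    show "u x \<le> M * ruin x" by (rule LIMSEQ_le_const2[OF conv[OF x]]) (use vb[OF x] in auto)
  qed
  have uM: "0 \<le> x \<Longrightarrow> \<bar>u x\<bar> \<le> M" for x using ub[of x] Mr[of x] by linarith
  have eq: "u x = f x + gain_op u x" if x: "0 \<le> x" for x
  proof -
    have "(\<lambda>n. gain_op (v n) x) \<longlonglongrightarrow> gain_op u x"
      unfolding gain_op_def
    proof (rule integral_dominated_convergence[where w = "\<lambda>_. M"])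
      show "AE z in N. (\<lambda>n. gain_kernel (v n) x z) \<longlonglongrightarrow> gain_kernel u x z"
      proof (rule AE_I2)
        fix z
        have "0 \<le> g * (d * x - fst z) + snd z" if "0 \<le> fst z \<and> fst z < d * x \<and> 0 \<le> snd z"
          using that pos by (intro add_nonneg_nonneg mult_nonneg_nonneg) auto
        then show "(\<lambda>n. gain_kernel (v n) x z) \<longlonglongrightarrow> gain_kernel u x z"
          using conv by (auto simp: gain_kernel_def)
      qed
      show "AE z in N. norm (gain_kernel (v n) x z) \<le> M" for n
        using gain_kernel_bound[of "v n" M x] vM M0 by auto
    qed simp_all
    then have "(\<lambda>n. v (Suc n) x) \<longlonglongrightarrow> f x + gain_op u x"
      unfolding vS by (intro tendsto_intros)
    moreover have "(\<lambda>n. v (Suc n) x) \<longlonglongrightarrow> u x"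
      using conv[OF x] by (rule LIMSEQ_Suc)
    ultimately show ?thesis by (rule LIMSEQ_unique[symmetric])
  qed
  have lim: "(u \<longlongrightarrow> 0) at_top" if "1 < r"
  proof (rule tendsto_sandwich[of "\<lambda>_. 0" _ _ "\<lambda>x. M * ruin x"])
    show "\<forall>\<^sub>F x in at_top. 0 \<le> u x" "\<forall>\<^sub>F x in at_top. u x \<le> M * ruin x"
      using eventually_ge_at_top[of 0] by (eventually_elim, simp add: ub)+
    show "((\<lambda>x. M * ruin x) \<longlongrightarrow> 0) at_top"
      using tendsto_mult[OF tendsto_const[of M] ruin_tendsto_0[OF that]] by simp
  qed simp
  have "\<bar>f x\<bar> \<le> M" if "0 \<le> x" for x
  proof -
    have "M * exp (- lam * x * d) \<le> M * 1"
      using M0 lam pos that by (intro mult_left_mono) auto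
    then show ?thesis using bd[OF that] by linarith
  qed
  then have "solves f u"
    by (rule solvesI[OF f um _ uM eq lim])
  then show ?thesis by blast
qed

text \<open>Adding \<open>M * exp (- lam * x * d)\<close> makes the forcing nonnegative; by
  linearity the addition is undone by subtracting \<open>M\<close> times the solution
  \<open>ruin\<close>.\<close>

lemma ex_solves:
  assumes f [measurable]: "f \<in> borel_measurable borel"
    and bd: "\<And>x. 0 \<le> x \<Longrightarrow> \<bar>f x\<bar> \<le> M * exp (- lam * x * d)"
  shows "\<exists>u. solves f u"
proof -
  have "\<exists>u. solves (\<lambda>x. f x + M * exp (- lam * x * d)) u"
  proof (rule ex_solves_nonneg[where M = "2 * M"])
    show "0 \<le> f x + M * exp (- lam * x * d)" "f x + M * exp (- lam * x * d) \<le> 2 * M * exp (- lam * x * d)"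
      if "0 \<le> x" for x using bd[OF that] by linarith+
  qed measurable
  then obtain u where "solves (\<lambda>x. f x + M * exp (- lam * x * d)) u" by blast
  from solves_linear[OF this solves_ruin, of "- M"] show ?thesis by auto
qed


text \<open>Each step multiplies the Laplace transform by \<open>\<kappa> + \<sigma> * exp (- s)\<close>.\<close>

primrec test_fn :: "real \<Rightarrow> real \<Rightarrow> nat \<Rightarrow> real \<Rightarrow> real" where
  "test_fn \<kappa> \<sigma> 0 x = (if 0 \<le> x then exp (- lam * x * d) else 0)"
| "test_fn \<kappa> \<sigma> (Suc n) x = \<kappa> * test_fn \<kappa> \<sigma> n x + \<sigma> * test_fn \<kappa> \<sigma> n (x - 1)"

lemma measurable_test_fn [measurable]: "test_fn \<kappa> \<sigma> n \<in> borel_measurable borel"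
proof (induction n)
  case (Suc n)
  note Suc[measurable]
  show ?case unfolding test_fn.simps(2)[abs_def] by measurable
qed (simp add: fun_eq_iff[symmetric])

lemma test_fn_neg: "x < 0 \<Longrightarrow> test_fn \<kappa> \<sigma> n x = 0"
  by (induction n arbitrary: x) auto

text \<open>Domination by the no-gain exponential is what \<open>ex_solves\<close> asks for; a shift
  by 1 enlarges the constant by the factor \<open>exp (lam * d)\<close>.\<close>

lemma test_fn_bound: "\<exists>M\<ge>0. \<forall>x. \<bar>test_fn \<kappa> \<sigma> n x\<bar> \<le> M * exp (- lam * x * d)"
proof (induction n)
  case 0
  show ?case by (intro exI[of _ 1]) auto
next
  case (Suc n)
  then obtain M where M: "0 \<le> M" "\<And>x. \<bar>test_fn \<kappa> \<sigma> n x\<bar> \<le> M * exp (- lam * x * d)" by auto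
  have "\<bar>test_fn \<kappa> \<sigma> (Suc n) x\<bar> \<le> (\<bar>\<kappa>\<bar> * M + \<bar>\<sigma>\<bar> * M * exp (lam * d)) * exp (- lam * x * d)" for x
  proof -
    have "\<bar>test_fn \<kappa> \<sigma> (Suc n) x\<bar> \<le> \<bar>\<kappa>\<bar> * \<bar>test_fn \<kappa> \<sigma> n x\<bar> + \<bar>\<sigma>\<bar> * \<bar>test_fn \<kappa> \<sigma> n (x - 1)\<bar>"
      using abs_triangle_ineq by (simp add: abs_mult[symmetric])
    also have "\<dots> \<le> \<bar>\<kappa>\<bar> * (M * exp (- lam * x * d)) + \<bar>\<sigma>\<bar> * (M * exp (- lam * (x - 1) * d))"
      by (intro add_mono mult_left_mono M) auto
    also have "exp (- lam * (x - 1) * d) = exp (lam * d) * exp (- lam * x * d)"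
      by (simp add: mult_exp_exp algebra_simps)
    finally show ?thesis by (simp add: algebra_simps)
  qed
  then show ?case using M by (intro exI[of _ "\<bar>\<kappa>\<bar> * M + \<bar>\<sigma>\<bar> * M * exp (lam * d)"]) auto
qed

text \<open>Vanishing on the negative axis ensures that the translation brings no new mass into the
  half-line.\<close>

lemma laplace_transform_shift:
  assumes "\<And>x. x < 0 \<Longrightarrow> f x = 0" and [measurable]: "f \<in> borel_measurable borel"
  shows "laplace_transform (\<lambda>x. f (x - 1)) s = exp (- s) * laplace_transform f s"
proof -
  let ?h = "\<lambda>x. indicator {0..} x *\<^sub>R (exp (- s * of_real x) * complex_of_real (f (x - 1)))"
  have "(\<integral>x. ?h x \<partial>lborel) = (\<integral>x. ?h (1 + x) \<partial>lborel)"
    using lborel_integral_real_affine[of 1 ?h 1] by simp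
  also have "\<dots> = (\<integral>x. exp (- s) * (indicator {0..} x *\<^sub>R (exp (- s * of_real x) * complex_of_real (f x))) \<partial>lborel)"
  proof (rule Bochner_Integration.integral_cong)
    fix x
    have "exp (- s * of_real (1 + x)) = exp (- s) * exp (- s * of_real x)"
      by (simp add: algebra_simps flip: exp_add)
    then show "?h (1 + x) = exp (- s) * (indicator {0..} x *\<^sub>R (exp (- s * of_real x) * complex_of_real (f x)))"
      using assms(1)[of x] by (cases "x < 0") (auto simp: indicator_def)
  qed simp
  finally show ?thesis
    unfolding laplace_transform_def set_lebesgue_integral_def by (simp only: integral_mult_right_zero)
qed

lemma laplace_no_gain:
  assumes "0 < Re s"
  shows "laplace_transform (\<lambda>x. exp (- lam * x * d)) s = 1 / (s + of_real (lam * d))"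
proof -
  have "laplace_transform (\<lambda>x. exp (- (lam * d) * x)) s = 1 / (s + of_real (lam * d))"
    using assms lam pos mult_pos_pos[of lam d] by (intro laplace_transform_exp) linarith
  then show ?thesis by (simp add: mult_ac)
qed

lemma laplace_test_fn:
  assumes s: "0 < Re s"
  shows "laplace_transform (test_fn \<kappa> \<sigma> n) s = (of_real \<kappa> + of_real \<sigma> * exp (- s)) ^ n / (s + of_real (lam * d))"
proof (induction n)
  case 0
  have "laplace_transform (test_fn \<kappa> \<sigma> 0) s = laplace_transform (\<lambda>x. exp (- lam * x * d)) s"
    unfolding laplace_transform_def set_lebesgue_integral_def
    by (rule Bochner_Integration.integral_cong) (auto simp: indicator_def)
  then show ?case by (simp only: laplace_no_gain[OF s] power_0)
next
  case (Suc n)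
  obtain M where M: "0 \<le> M" "\<And>x. \<bar>test_fn \<kappa> \<sigma> n x\<bar> \<le> M * exp (- lam * x * d)"
    using test_fn_bound by blast
  have b: "\<bar>test_fn \<kappa> \<sigma> n x\<bar> \<le> M" if "0 \<le> x" for x
  proof -
    have "M * exp (- lam * x * d) \<le> M * 1"
      using M lam pos that by (intro mult_left_mono) auto
    then show ?thesis using M(2)[of x] by linarith
  qed
  have b1: "\<bar>test_fn \<kappa> \<sigma> n (x - 1)\<bar> \<le> M" for x
    using b[of "x - 1"] M(1) test_fn_neg[of "x - 1"] by (cases "1 \<le> x") auto
  let ?L = "\<lambda>f x. indicator {0..} x *\<^sub>R (exp (- s * of_real x) * complex_of_real (f x))"
  have i: "integrable lborel (?L (test_fn \<kappa> \<sigma> n))" "integrable lborel (?L (\<lambda>x. test_fn \<kappa> \<sigma> n (x - 1)))"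
    by (rule laplace_transform_integrable[where M = M]; use s b b1 in simp)+
  have "laplace_transform (test_fn \<kappa> \<sigma> (Suc n)) s
      = (\<integral>x. of_real \<kappa> * ?L (test_fn \<kappa> \<sigma> n) x + of_real \<sigma> * ?L (\<lambda>x. test_fn \<kappa> \<sigma> n (x - 1)) x \<partial>lborel)"
    unfolding laplace_transform_def set_lebesgue_integral_def
    by (rule Bochner_Integration.integral_cong) (auto simp: indicator_def algebra_simps)
  also have "\<dots> = of_real \<kappa> * laplace_transform (test_fn \<kappa> \<sigma> n) s
      + of_real \<sigma> * laplace_transform (\<lambda>x. test_fn \<kappa> \<sigma> n (x - 1)) s"
    unfolding laplace_transform_def set_lebesgue_integral_def using i
    by (subst Bochner_Integration.integral_add) (auto simp only: integral_mult_right_zero intro!: integrable_mult_right)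
  also have "laplace_transform (\<lambda>x. test_fn \<kappa> \<sigma> n (x - 1)) s = exp (- s) * laplace_transform (test_fn \<kappa> \<sigma> n) s"
    by (rule laplace_transform_shift) (auto intro: test_fn_neg)
  finally show ?case unfolding Suc by (simp add: algebra_simps add_divide_distrib)
qed

section \<open>The linear system for the two unknowns\<close>

lemma summable_J_prod_mult:
  assumes "s \<noteq> 0" "r \<noteq> 1" "Bseq h"
  shows "summable (\<lambda>k. norm (J_prod k s * h k))"
proof -
  obtain K where K: "\<And>k. norm (h k) \<le> K" using assms(3) by (auto simp: Bseq_def)
  have "summable (\<lambda>k. norm (J_prod k s) * K)"
    using summable_J_prod[of s] assms by (intro summable_mult2) auto
  then show ?thesis
    by (rule summable_comparison_test'[where N = 0]) (use K in \<open>auto simp: norm_mult intro!: mult_left_mono\<close>)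
qed

lemma Bseq_coef:
  assumes "s \<noteq> 0" "r \<noteq> 1"
  shows "Bseq (\<lambda>k. coef1 (s / of_real (r ^ k)))" "Bseq (\<lambda>k. coef2 (s / of_real (r ^ k)))"
proof -
  consider "1 < r" | "r < 1" using assms by linarith
  then show "Bseq (\<lambda>k. coef1 (s / of_real (r ^ k)))" "Bseq (\<lambda>k. coef2 (s / of_real (r ^ k)))"
    by (cases; use coef_tendsto[OF assms(1)] in \<open>blast intro: convergent_imp_Bseq convergentI\<close>)+
qed

text \<open>Up to sign, \<open>row1 s\<close> and \<open>row2 s\<close> are the total coefficients
  of the two unknowns in the series at \<open>s\<close>. The substitutions \<open>s = \<mu>\<close>
  and \<open>s = 2 \<mu>\<close> give a system whose matrix is the identity plus the matrix with
  rows \<open>(row1 s, row2 s)\<close>.\<close>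

definition row1 :: "complex \<Rightarrow> complex" where "row1 s = (\<Sum>k. J_prod k s * coef1 (s / of_real (r ^ k)))"
definition row2 :: "complex \<Rightarrow> complex" where "row2 s = (\<Sum>k. J_prod k s * coef2 (s / of_real (r ^ k)))"

lemma row_sums:
  assumes "s \<noteq> 0" "r \<noteq> 1"
  shows "(\<lambda>k. J_prod k s * coef1 (s / of_real (r ^ k))) sums row1 s"
    and "(\<lambda>k. J_prod k s * coef2 (s / of_real (r ^ k))) sums row2 s"
  unfolding row1_def row2_def using summable_J_prod_mult[OF assms Bseq_coef(1)[OF assms]] summable_J_prod_mult[OF assms Bseq_coef(2)[OF assms]]
  by (auto intro!: summable_sums dest: summable_norm_cancel)

text \<open>The terms with the unknowns are moved to the other side. At \<open>s = \<mu>\<close> and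
  \<open>s = 2 \<mu>\<close> the two sums form the system matrix applied to the transform values of
  \<open>u\<close>, so a left null vector of that matrix annihilates the pair of forcing
  series.\<close>

lemma forcing_series:
  assumes sol: "solves f u" and s: "regular s" and r: "r \<noteq> 1"
  shows "(\<lambda>k. J_prod k s * laplace_transform f (s / of_real (r ^ k))) sums
    (laplace_transform u s + row1 s * laplace_transform u (of_real \<mu>) + row2 s * laplace_transform u (of_real (2 * \<mu>)))"
proof -
  have s0: "s \<noteq> 0" using s by (auto simp: regular_def)
  have "(\<lambda>k. J_prod k s * (laplace_transform f (s / of_real (r ^ k))
       - coef1 (s / of_real (r ^ k)) * laplace_transform u (of_real \<mu>)
       - coef2 (s / of_real (r ^ k)) * laplace_transform u (of_real (2 * \<mu>))) +
       J_prod k s * coef1 (s / of_real (r ^ k)) * laplace_transform u (of_real \<mu>)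
       + J_prod k s * coef2 (s / of_real (r ^ k)) * laplace_transform u (of_real (2 * \<mu>)))
    sums (laplace_transform u s + row1 s * laplace_transform u (of_real \<mu>) + row2 s * laplace_transform u (of_real (2 * \<mu>)))"
    by (intro sums_add sums_mult2 row_sums s0 r laplace_series[OF sol s]) (use r in auto)
  then show ?thesis by (simp add: algebra_simps)
qed

text \<open>If the matrix were singular, a left null vector \<open>(\<alpha>, \<beta>)\<close> would
  relate the series at \<open>\<mu>\<close> and at \<open>2 \<mu>\<close> linearly for every power
  \<open>n\<close> of the test factor; comparing growth in \<open>n\<close> excludes this.\<close>

lemma no_homogeneous_solution:
  assumes r: "r \<noteq> 1" and reg: "regular (of_real \<mu>)" "regular (of_real (2 * \<mu>))"
    and hom: "(1 + row1 (of_real \<mu>)) * P + row2 (of_real \<mu>) * Q = 0"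
      "row1 (of_real (2 * \<mu>)) * P + (1 + row2 (of_real (2 * \<mu>))) * Q = 0"
  shows "P = 0 \<and> Q = 0"
proof (rule ccontr)
  assume "\<not> (P = 0 \<and> Q = 0)"
  then obtain \<alpha> \<beta> where ne: "\<alpha> \<noteq> 0 \<or> \<beta> \<noteq> 0"
    and null: "\<alpha> * (1 + row1 (of_real \<mu>)) + \<beta> * row1 (of_real (2 * \<mu>)) = 0"
      "\<alpha> * row2 (of_real \<mu>) + \<beta> * (1 + row2 (of_real (2 * \<mu>))) = 0"
    using left_null_vector_2x2[OF hom] by blast
  \<comment> \<open>The test factor \<open>t\<close> is \<open>1 - exp (- x)\<close>, increasing, if
    \<open>1 < r\<close>, where orbits decrease, and \<open>exp (- x)\<close>, decreasing, if
    \<open>r < 1\<close>, where orbits increase. Either way the starting point of an orbit has the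
    strictly largest factor of that orbit.\<close>
  define \<kappa> \<sigma> :: real where "\<kappa> = (if 1 < r then 1 else 0)" and "\<sigma> = (if 1 < r then - 1 else 1)"
  define t where "t x = \<kappa> + \<sigma> * exp (- x)" for x :: real
  define w where "w s k = J_prod k (of_real s) / (of_real (s / r ^ k) + of_real (lam * d))" for s k
  define \<tau> where "\<tau> s k = t (s / r ^ k)" for s and k :: nat
  have zero: "\<alpha> * (\<Sum>k. w \<mu> k * of_real (\<tau> \<mu> k) ^ n) + \<beta> * (\<Sum>k. w (2 * \<mu>) k * of_real (\<tau> (2 * \<mu>) k) ^ n) = 0" for n
  proof -
    obtain M where M: "\<And>x. \<bar>test_fn \<kappa> \<sigma> n x\<bar> \<le> M * exp (- lam * x * d)"
      using test_fn_bound by blast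
    obtain u where u: "solves (test_fn \<kappa> \<sigma> n) u"
      using ex_solves[OF measurable_test_fn M] by blast
    define U where "U = laplace_transform u"
    have ser: "(\<Sum>k. w s k * of_real (\<tau> s k) ^ n) = U (of_real s) + row1 (of_real s) * U (of_real \<mu>) + row2 (of_real s) * U (of_real (2 * \<mu>))"
      if "regular (of_real s)" "0 < s" for s
    proof -
      have "laplace_transform (test_fn \<kappa> \<sigma> n) (of_real s / of_real (r ^ k)) = of_real (\<tau> s k) ^ n / (of_real (s / r ^ k) + of_real (lam * d))" for k
        using laplace_test_fn[of "of_real (s / r ^ k)" \<kappa> \<sigma> n] that pos
        by (simp add: \<tau>_def t_def exp_of_real[symmetric])
      then have "(\<lambda>k. w s k * of_real (\<tau> s k) ^ n) sums (U (of_real s) + row1 (of_real s) * U (of_real \<mu>) + row2 (of_real s) * U (of_real (2 * \<mu>)))"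
        using forcing_series[OF u that(1) r] by (simp add: w_def U_def)
      then show ?thesis by (rule sums_unique[symmetric])
    qed
    have "\<alpha> * (\<Sum>k. w \<mu> k * of_real (\<tau> \<mu> k) ^ n) + \<beta> * (\<Sum>k. w (2 * \<mu>) k * of_real (\<tau> (2 * \<mu>) k) ^ n)
      = (\<alpha> * (1 + row1 (of_real \<mu>)) + \<beta> * row1 (of_real (2 * \<mu>))) * U (of_real \<mu>)
      + (\<alpha> * row2 (of_real \<mu>) + \<beta> * (1 + row2 (of_real (2 * \<mu>)))) * U (of_real (2 * \<mu>))"
      using mu by (subst ser[OF reg(1)], simp, subst ser[OF reg(2)]) (simp, simp add: algebra_simps)
    then show ?thesis using null by simp
  qed
  have w_sum: "summable (\<lambda>k. norm (w s k))" if "0 < s" for s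
  proof -
    have "Bseq (\<lambda>k. 1 / (of_real (s / r ^ k) + of_real (lam * d)) :: complex)"
    proof (rule BseqI')
      fix k
      have "lam * d \<le> s / r ^ k + lam * d" using that pos by simp
      then have "1 / (s / r ^ k + lam * d) \<le> 1 / (lam * d)"
        using lam pos by (intro divide_left_mono) (auto intro!: mult_pos_pos add_pos_pos that divide_pos_pos)
      moreover have "norm (1 / (of_real (s / r ^ k) + of_real (lam * d)) :: complex) = 1 / (s / r ^ k + lam * d)"
        using that pos lam by (simp add: norm_divide add_pos_pos flip: of_real_add of_real_divide of_real_power of_real_mult)
      ultimately show "norm (1 / (of_real (s / r ^ k) + of_real (lam * d)) :: complex) \<le> 1 / (lam * d)"
        by simp
    qed
    from summable_J_prod_mult[OF _ r this, of "of_real s"] that show ?thesis by (simp add: w_def)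
  qed
  have w0: "w s 0 \<noteq> 0" if "0 < s" for s
  proof -
    have "of_real s + of_real (lam * d) \<noteq> (0::complex)"
      by (rule denominators_nonzero) (use that lam in auto)
    then show ?thesis by (simp add: w_def J_prod_def)
  qed
  have tnn: "0 \<le> \<tau> s k" if "0 < s" for s k
    using that pos by (simp add: \<tau>_def t_def \<kappa>_def \<sigma>_def)
  consider "1 < r" | "r < 1" using r by linarith
  then show False
  proof cases
    case 1
    have t: "t x < t y \<longleftrightarrow> x < y" for x y using 1 by (simp add: t_def \<kappa>_def \<sigma>_def)
    have rk: "1 < r ^ k" if "0 < k" for k using 1 that by (simp add: one_less_power)
    have rk1: "1 \<le> r ^ k" for k using 1 by (simp add: one_le_power)
    have l1: "s / r ^ k < s" if "0 < s" "0 < k" for s k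
      using rk[OF that(2)] that by (simp add: divide_less_eq)
    have l2: "\<mu> / r ^ k < 2 * \<mu>" for k
      using rk1[of k] mu pos by (simp add: divide_less_eq)
    \<comment> \<open>Here \<open>2 \<mu>\<close> lies above all other points of both orbits, so
      \<open>\<beta>\<close> is isolated first.\<close>
    have "\<beta> = 0 \<and> \<alpha> = 0"
      using geometric_mixtures_independent[of "w (2 * \<mu>)" "w \<mu>" "\<tau> (2 * \<mu>)" "\<tau> \<mu>" \<beta> \<alpha>]
        w_sum w0 tnn mu zero l1 l2
      by (simp add: \<tau>_def t add.commute)
    then show False using ne by simp
  next
    case 2
    have t: "t x < t y \<longleftrightarrow> y < x" for x y using 2 by (simp add: t_def \<kappa>_def \<sigma>_def)
    have rk: "r ^ k < 1" if "0 < k" for k using 2 pos that by (simp add: power_less_one_iff)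
    have rk1: "r ^ k \<le> 1" for k using 2 pos by (simp add: power_le_one)
    have l1: "s < s / r ^ k" if "0 < s" "0 < k" for s k
      using rk[OF that(2)] that pos by (simp add: less_divide_eq)
    have l2: "\<mu> < 2 * \<mu> / r ^ k" for k
      using rk1[of k] mu pos by (simp add: less_divide_eq)
    \<comment> \<open>Here \<open>\<mu>\<close> lies below all other points of both orbits, so
      \<open>\<alpha>\<close> is isolated first.\<close>
    have "\<alpha> = 0 \<and> \<beta> = 0"
      using geometric_mixtures_independent[of "w \<mu>" "w (2 * \<mu>)" "\<tau> \<mu>" "\<tau> (2 * \<mu>)" \<alpha> \<beta>]
        w_sum w0 tnn mu zero l1 l2
      by (simp add: \<tau>_def t)
    then show False using ne by simp
  qed
qed


section \<open>Back to the series in terms of \<open>J\<close>, \<open>H\<close> and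
  \<open>zeta\<close>\<close>

lemma regular_iff: "regular s \<longleftrightarrow> 0 < Re s \<and> terms_defined \<mu> a c s"
  unfolding regular_def terms_defined_def zeta_funpow
  by (simp add: r_def d_def g_def mult.assoc)

lemma regularD:
  assumes "regular s"
  shows "0 < Re (s / of_real (r ^ k))" "s / of_real (r ^ k) \<noteq> of_real (\<mu> * r)"
    "s / of_real (r ^ k) \<noteq> of_real (2 * \<mu> * r)"
  using assms pos by (auto simp: regular_def Re_divide_of_real)

lemma J_eq_J_sum:
  assumes "regular s"
  shows "J lam \<mu> a c \<theta> (s / of_real (r ^ k)) = J_sum (s / of_real (r ^ k))"
  unfolding J_sum_def by (rule J_H_eq_coef) (use regularD[OF assms] in blast)+

lemma series_term_eq:
  assumes "regular s"
  shows "series_term lam \<mu> a c \<theta> p q s k = J_prod k s * (1 / (s / of_real (r ^ k) + of_real (lam * d))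
     - coef1 (s / of_real (r ^ k)) * p - coef2 (s / of_real (r ^ k)) * q)"
  unfolding series_term_def zeta_funpow J_prod_def J_eq_J_sum[OF assms] J_H_eq_coef(2)[OF regularD[OF assms]] ..

lemma ruin_series:
  assumes s: "regular s" and conv: "r = 1 \<Longrightarrow> norm (J lam \<mu> a c \<theta> s) < 1"
  shows "series_term lam \<mu> a c \<theta> (laplace_transform ruin (of_real \<mu>)) (laplace_transform ruin (of_real (2 * \<mu>))) s
    sums laplace_transform ruin s"
proof -
  have "series_term lam \<mu> a c \<theta> (laplace_transform ruin (of_real \<mu>)) (laplace_transform ruin (of_real (2 * \<mu>))) s
    = (\<lambda>k. J_prod k s * (laplace_transform (\<lambda>x. exp (- lam * x * d)) (s / of_real (r ^ k))
       - coef1 (s / of_real (r ^ k)) * laplace_transform ruin (of_real \<mu>)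
       - coef2 (s / of_real (r ^ k)) * laplace_transform ruin (of_real (2 * \<mu>))))"
    unfolding fun_eq_iff series_term_eq[OF s] laplace_no_gain[OF regularD(1)[OF s]] by blast
  moreover have "r = 1 \<Longrightarrow> norm (J_sum s) < 1"
    using conv J_eq_J_sum[OF s, of 0] by simp
  ultimately show ?thesis
    using laplace_series[OF solves_ruin s] by simp
qed

text \<open>\<open>H\<close> is affine in the unknowns, so the difference between a solution of the
  system and the pair of true transform values solves the homogeneous system.\<close>

lemma series_unique:
  assumes reg: "regular (of_real \<mu>)" "regular (of_real (2 * \<mu>))"
    and p: "series_term lam \<mu> a c \<theta> p q (of_real \<mu>) sums p"
    and q: "series_term lam \<mu> a c \<theta> p q (of_real (2 * \<mu>)) sums q"
  shows "p = laplace_transform ruin (of_real \<mu>) \<and> q = laplace_transform ruin (of_real (2 * \<mu>))"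
proof -
  \<comment> \<open>For \<open>r = 1\<close> the point \<open>\<mu>\<close> would equal the pole
    \<open>\<mu> r\<close>, which \<open>regular\<close> excludes.\<close>
  have r: "r \<noteq> 1" using regularD(2)[OF reg(1), of 0] by auto
  let ?p = "laplace_transform ruin (of_real \<mu>)" and ?q = "laplace_transform ruin (of_real (2 * \<mu>))"
  have diff: "y - z + row1 s * (p - ?p) + row2 s * (q - ?q) = 0"
    if s: "regular s" and y: "series_term lam \<mu> a c \<theta> p q s sums y"
      and z: "series_term lam \<mu> a c \<theta> ?p ?q s sums z" for s y z
  proof -
    have s0: "s \<noteq> 0" using s by (auto simp: regular_def)
    have "(\<lambda>k. (series_term lam \<mu> a c \<theta> p q s k - series_term lam \<mu> a c \<theta> ?p ?q s k)
        + J_prod k s * coef1 (s / of_real (r ^ k)) * (p - ?p) + J_prod k s * coef2 (s / of_real (r ^ k)) * (q - ?q))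
      sums (y - z + row1 s * (p - ?p) + row2 s * (q - ?q))"
      by (intro sums_add sums_diff sums_mult2 row_sums s0 r y z)
    moreover have "(series_term lam \<mu> a c \<theta> p q s k - series_term lam \<mu> a c \<theta> ?p ?q s k)
        + J_prod k s * coef1 (s / of_real (r ^ k)) * (p - ?p) + J_prod k s * coef2 (s / of_real (r ^ k)) * (q - ?q) = 0" for k
      unfolding series_term_eq[OF s] by (simp add: algebra_simps)
    ultimately show ?thesis by (simp add: sums_0 sums_unique2)
  qed
  have "(1 + row1 (of_real \<mu>)) * (p - ?p) + row2 (of_real \<mu>) * (q - ?q) = 0"
    using diff[OF reg(1) p ruin_series[OF reg(1)]] r by (simp add: algebra_simps)
  moreover have "row1 (of_real (2 * \<mu>)) * (p - ?p) + (1 + row2 (of_real (2 * \<mu>))) * (q - ?q) = 0"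
    using diff[OF reg(2) q ruin_series[OF reg(2)]] r by (simp add: algebra_simps)
  ultimately have "p - ?p = 0 \<and> q - ?q = 0"
    by (rule no_homogeneous_solution[OF r reg])
  then show ?thesis by simp
qed

section \<open>Transfer to the given probability space\<close>

text \<open>Independence and the common law make the sequence of pairs distributed as the product
  measure \<open>S\<close>, and ruin depends on the outcome only through that sequence.\<close>

lemma ruin_prob_eq_ruin:
  fixes M :: "'w measure" and B C :: "nat \<Rightarrow> 'w \<Rightarrow> real"
  assumes M: "prob_space M"
    and iid: "prob_space.indep_vars M (\<lambda>_. borel) (\<lambda>n \<omega>. (B n \<omega>, C n \<omega>)) UNIV"
    and law: "\<And>n. distributed M lborel (\<lambda>\<omega>. (B n \<omega>, C n \<omega>))
                     (\<lambda>z. ennreal (fgm_exp_density lam \<mu> \<theta> z))"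
  shows "ruin_prob M B C a c x = ruin x"
proof -
  interpret M: prob_space M by (rule M)
  let ?Z = "\<lambda>n \<omega>. (B n \<omega>, C n \<omega>)"
  have Zm: "?Z n \<in> M \<rightarrow>\<^sub>M borel" for n
    using distributed_measurable[OF law[of n]] by simp
  have "distr M (\<Pi>\<^sub>M i\<in>UNIV. borel) (\<lambda>\<omega>. \<lambda>i\<in>UNIV. ?Z i \<omega>) = (\<Pi>\<^sub>M i\<in>UNIV. distr M borel (?Z i))"
    using M.indep_vars_iff_distr_eq_PiM[of "UNIV :: nat set" ?Z "\<lambda>_. borel"] Zm iid by simp
  moreover have "distr M borel (?Z i) = N" for i
  proof -
    have "distr M borel (?Z i) = distr M lborel (?Z i)"
      by (rule distr_cong) auto
    then show ?thesis
      using distributed_distr_eq_density[OF law[of i]] by (simp add: N_def)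
  qed
  ultimately have D: "distr M (\<Pi>\<^sub>M i\<in>UNIV. borel) (\<lambda>\<omega> i. ?Z i \<omega>) = S"
    by (simp add: restrict_UNIV)
  have sets: "sets (\<Pi>\<^sub>M i\<in>(UNIV::nat set). borel :: (real \<times> real) measure) = sets S"
    by (rule sets_PiM_cong) simp_all
  have m: "(\<lambda>\<omega> i. ?Z i \<omega>) \<in> M \<rightarrow>\<^sub>M (\<Pi>\<^sub>M i\<in>UNIV. borel)"
    using measurable_restrict[of UNIV ?Z M "\<lambda>_. borel"] Zm by (simp add: restrict_UNIV)
  have "ruin x = measure (distr M (\<Pi>\<^sub>M i\<in>UNIV. borel) (\<lambda>\<omega> i. ?Z i \<omega>)) {w. ruined_on x w}"
    unfolding D ruin_def ..
  also have "\<dots> = measure M ((\<lambda>\<omega> i. ?Z i \<omega>) -` {w. ruined_on x w} \<inter> space M)"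
    by (rule measure_distr[OF m]) (simp only: sets sets_ruined)
  also have "(\<lambda>\<omega> i. ?Z i \<omega>) -` {w. ruined_on x w} \<inter> space M
      = {\<omega> \<in> space M. ruined a c (\<lambda>n. B n \<omega>) (\<lambda>n. C n \<omega>) x}"
    by auto
  finally show ?thesis by (simp add: ruin_prob_def)
qed

end

theorem theorem12:
  fixes M :: "'w measure" and B C :: "nat \<Rightarrow> 'w \<Rightarrow> real"
    and lam \<mu> a c \<theta> :: real and R :: "real \<Rightarrow> real" and \<rho> :: "complex \<Rightarrow> complex"
  assumes "lam > 0" and "\<mu> > 0" and "a \<ge> 0" and "0 < c" and "c < 1" and "-1 \<le> \<theta>" and "\<theta> \<le> 1"
    and "prob_space M"
    and iid: "prob_space.indep_vars M (\<lambda>_. borel) (\<lambda>n \<omega>. (B n \<omega>, C n \<omega>)) UNIV"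
    and law: "\<And>n. distributed M lborel (\<lambda>\<omega>. (B n \<omega>, C n \<omega>))
                     (\<lambda>z. ennreal (fgm_exp_density lam \<mu> \<theta> z))"
  defines "R \<equiv> ruin_prob M B C a c"
    and "\<rho> \<equiv> laplace_transform R"
  shows
    "(\<forall>s. Re s > 0 \<longrightarrow> terms_defined \<mu> a c s \<longrightarrow>
          ((1 - c) * (1 + a) = 1 \<longrightarrow> norm (J lam \<mu> a c \<theta> s) < 1) \<longrightarrow>
        series_term lam \<mu> a c \<theta> (\<rho> (of_real \<mu>)) (\<rho> (of_real (2 * \<mu>))) s sums \<rho> s)
     \<and> (terms_defined \<mu> a c (of_real \<mu>) \<longrightarrow> terms_defined \<mu> a c (of_real (2 * \<mu>)) \<longrightarrow>
        (\<forall>p q. series_term lam \<mu> a c \<theta> p q (of_real \<mu>) sums p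
               \<and> series_term lam \<mu> a c \<theta> p q (of_real (2 * \<mu>)) sums q
             \<longleftrightarrow> p = \<rho> (of_real \<mu>) \<and> q = \<rho> (of_real (2 * \<mu>))))"
proof -
  interpret fgm_dual_risk lam \<mu> a c \<theta>
    by unfold_locales (use assms in auto)
  have \<rho>: "\<rho> = laplace_transform ruin"
  proof -
    have "ruin_prob M B C a c = ruin"
      by (rule ext) (rule ruin_prob_eq_ruin[OF \<open>prob_space M\<close> iid law])
    then show ?thesis unfolding \<rho>_def R_def by simp
  qed
  have r1: "(1 - c) * (1 + a) = 1 \<longleftrightarrow> r = 1"
    by (simp add: r_def d_def g_def)
  have series: "series_term lam \<mu> a c \<theta> (\<rho> (of_real \<mu>)) (\<rho> (of_real (2 * \<mu>))) s sums \<rho> s"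
    if "0 < Re s" "terms_defined \<mu> a c s" "(1 - c) * (1 + a) = 1 \<longrightarrow> norm (J lam \<mu> a c \<theta> s) < 1" for s
    unfolding \<rho> by (rule ruin_series) (use that r1 regular_iff in auto)
  have unique: "series_term lam \<mu> a c \<theta> p q (of_real \<mu>) sums p
       \<and> series_term lam \<mu> a c \<theta> p q (of_real (2 * \<mu>)) sums q
     \<longleftrightarrow> p = \<rho> (of_real \<mu>) \<and> q = \<rho> (of_real (2 * \<mu>))" (is "?L \<longleftrightarrow> ?R")
    if td: "terms_defined \<mu> a c (of_real \<mu>)" "terms_defined \<mu> a c (of_real (2 * \<mu>))" for p q
  proof
    have reg: "regular (of_real \<mu>)" "regular (of_real (2 * \<mu>))"
      using td mu by (auto simp: regular_iff)
    show ?R if ?L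
      using series_unique[OF reg] that unfolding \<rho> by blast
    \<comment> \<open>With \<open>r = 1\<close> ruled out by regularity at \<open>\<mu>\<close>, the
      extra condition of the series identity holds vacuously.\<close>
    have "r \<noteq> 1" using regularD(2)[OF reg(1), of 0] by auto
    then show ?L if ?R
      using series[OF _ td(1)] series[OF _ td(2)] that mu r1 by simp
  qed
  show ?thesis
    using series unique by blast
qed

end
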